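(* Let $c\in\{1,-1,2,-2,4,-4\}$. Consider the equation $$\frac{ax^{n+2l}+c}{abt^2x^n+c}=by^2$$ in integers $a,b,x,y,n,t,l$ with $x>1$, $n>0$, $t>0$, $a>0$ and $\gcd(a,c)=1$. This equation holds if and only if $b=t=1$ or $b=|y|=1$, except for the solutions $(a,b,x,y,n,t,l,c)\in\{(1,-1,2,\pm3,1,1,1,1),(1,-1,2,\pm3,2,1,1,2),(1,-1,2,\pm3,3,1,1,4)\}$. Moreover, the solutions with $b=|y|=1$ are given by $x^l=t$, and the solutions with $b=t=1$ are exactly: for $c=-1$: $2\mid l$, $a=\frac{3^{l-1}+1}{4}$, $x=3$, $n=1$, $y=\pm(3^l+2)$; for $c=1$: $2\nmid l$, $a=\frac{3^{l-1}-1}{4}$, $x=3$, $n=1$, $y=\pm(3^l-2)$; for $c=-2$: $2\nmid l$, $a=\frac{3^{l-1}+1}{2}$, $x=3$, $n=1$, $y=\pm(3^l+2)$; for $c=2$: $2\mid l$, $a=\frac{3^{l-1}-1}{2}$, $x=3$, $n=1$, $y=\pm(3^l-2)$; for $c=-4$: $l=n=a=1$, $x=5$, $y=\pm11$; for $c=4$: there are none.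
   Formalization: l > 0 is assumed (the claim fails for l ≤ 0, e.g. (a,b,x,y,n,t,l,c) = (1,-1,5,±3,1,1,0,4)), and the solutions (1,-1,2,±3,1,2,2,4), missing from the stated exceptions, are added to them; the denominator is required to be nonzero. *)

theory Defs
  imports Complex_Main
begin

text \<open>
  The quotient is taken in \<^typ>\<open>rat\<close>. As division by zero yields zero there, a vanishing denominator
  would produce spurious solutions with \<open>y = 0\<close> (for instance \<open>a = b = t = l = n = 1\<close>, \<open>x = 2\<close>,
  \<open>c = -2\<close>), so the denominator is required to be nonzero.
\<close>

definition equation_holds ::
  "int \<Rightarrow> int \<Rightarrow> int \<Rightarrow> int \<Rightarrow> nat \<Rightarrow> int \<Rightarrow> nat \<Rightarrow> int \<Rightarrow> bool" where
  "equation_holds a b x y n t l c \<longleftrightarrow>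
     a * b * t^2 * x^n + c \<noteq> 0 \<and>
     (of_int (a * x^(n + 2*l) + c) :: rat) / of_int (a * b * t^2 * x^n + c) = of_int (b * y^2)"

text \<open>
  Tuples are ordered \<open>(a, b, x, y, n, t, l, c)\<close>. The last tuple is missing from the published list
  of exceptions, but it is a solution, \<open>(2^5 + 4) / (- 4 * 2 + 4) = - 9\<close>, with all the side
  conditions satisfied; it comes from \<open>(1, -1, 2, \<plusminus>3, 3, 1, 1, 4)\<close> by writing
  \<open>t^2 * x^n = 8\<close> as \<open>2^2 * 2^1\<close> instead of \<open>1^2 * 2^3\<close>.
\<close>

definition exceptional_solutions ::
  "(int \<times> int \<times> int \<times> int \<times> nat \<times> int \<times> nat \<times> int) set" where
  "exceptional_solutions = (\<Union>y \<in> {3, -3}.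
     {(1, -1, 2, y, 1, 1, 1, 1),
      (1, -1, 2, y, 2, 1, 1, 2),
      (1, -1, 2, y, 3, 1, 1, 4),
      (1, -1, 2, y, 1, 2, 2, 4)})"

text \<open>
  The subtraction \<open>l - 1\<close> on natural numbers is harmless: the predicate is only used for \<open>l > 0\<close>.
  There is no disjunct for \<open>c = 4\<close> because there are no such solutions.
\<close>

definition listed_bt1 :: "int \<Rightarrow> int \<Rightarrow> int \<Rightarrow> nat \<Rightarrow> nat \<Rightarrow> int \<Rightarrow> bool" where
  "listed_bt1 a x y n l c \<longleftrightarrow>
     (c = -1 \<and> even l \<and> (of_int a :: rat) = (3^(l - 1) + 1) / 4 \<and> x = 3 \<and> n = 1 \<and>
        (y = 3^l + 2 \<or> y = - (3^l + 2))) \<or>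
     (c = 1 \<and> odd l \<and> (of_int a :: rat) = (3^(l - 1) - 1) / 4 \<and> x = 3 \<and> n = 1 \<and>
        (y = 3^l - 2 \<or> y = - (3^l - 2))) \<or>
     (c = -2 \<and> odd l \<and> (of_int a :: rat) = (3^(l - 1) + 1) / 2 \<and> x = 3 \<and> n = 1 \<and>
        (y = 3^l + 2 \<or> y = - (3^l + 2))) \<or>
     (c = 2 \<and> even l \<and> (of_int a :: rat) = (3^(l - 1) - 1) / 2 \<and> x = 3 \<and> n = 1 \<and>
        (y = 3^l - 2 \<or> y = - (3^l - 2))) \<or>
     (c = -4 \<and> l = 1 \<and> n = 1 \<and> a = 1 \<and> x = 5 \<and> (y = 11 \<or> y = -11))"

end

theory Submission
  imports Defs "HOL-Computational_Algebra.Primes"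
begin

text \<open>
  Put \<open>q = a x\<^sup>n\<close>, \<open>z = x\<^sup>l\<close> and \<open>N = b q t\<^sup>2 + c\<close>. The equation becomes \<open>b N y\<^sup>2 - q z\<^sup>2 = c\<close>, while
  \<open>N - b q t\<^sup>2 = c\<close>, so that the unit \<open>(\<surd>N + t \<surd>(b q))\<^sup>2 / c\<close> acts on its solutions; the action is
  integral because \<open>c\<close> divides 4. Descent leads to a very small solution. For \<open>b < 0\<close> only
  finitely many parameters survive, and they reduce to \<open>y\<^sup>2 - 2 w\<^sup>2 = 1\<close> with \<open>w\<close> a power of 2.
  For \<open>b > 0\<close> the reduced solution is \<open>(1, t)\<close> with \<open>b = 1\<close> (a solution with \<open>y = 0\<close> would force \<open>z\<close> to
  be odd and \<open>x\<close> to be even), hence \<open>z = \<plusminus> t W\<close> with a Lucas number \<open>W\<close> of odd index \<open>m\<close> and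
  parameter \<open>S = 4 q t\<^sup>2 / c\<close>. Every prime factor of \<open>W\<close> divides \<open>x\<close>, hence \<open>S\<close>; since \<open>W \<equiv> m\<close> modulo
  \<open>S\<close>, it also divides \<open>m\<close>. As in Stoermer's theorem, if \<open>W \<noteq> \<plusminus> 1\<close> then for such a prime \<open>p\<close> the Lucas
  number of index \<open>p\<close> is, up to sign, a power of \<open>p\<close>, which for \<open>p \<ge> 5\<close> happens only for \<open>S = - 5\<close>. The prime
  3 yields \<open>W = \<plusminus> (S + 3)\<close>, and \<open>S + 3 = \<plusminus> 3\<^sup>l\<close> describes the families with \<open>x = 3\<close>.
\<close>

section \<open>A Lucas sequence with odd indices\<close>

text \<open>
  For \<open>S = 4 sinh\<^sup>2 \<theta>\<close> the value is \<open>sinh ((2 j + 1) \<theta>) / sinh \<theta>\<close>: the index \<open>j\<close> stands for the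
  odd number \<open>2 j + 1\<close>.
\<close>

fun lucasW :: "int \<Rightarrow> nat \<Rightarrow> int" where
  "lucasW S 0 = 1"
| "lucasW S (Suc 0) = S + 3"
| "lucasW S (Suc (Suc j)) = (S + 2) * lucasW S (Suc j) - lucasW S j"

lemma two_is_prime_int: "prime (2::int)"
  using two_is_prime_nat by (simp only: prime_int_numeral_eq)

text \<open>Binet's formula: with \<open>r\<close> = e^\<theta> and \<open>i\<close> =
  e^(-\<theta>), the recurrence factor \<open>S + 2\<close> is \<open>r^2 + i^2\<close>. Keeping
  \<open>r - i\<close> as a factor avoids a division.\<close>

lemma lucasW_closed_form:
  fixes r i :: complex
  assumes ri: "r * i = 1" and S: "(r - i)^2 = of_int S"
  shows "of_int (lucasW S j) * (r - i) = r^(2*j+1) - i^(2*j+1)"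
  using S
proof (induction S j rule: lucasW.induct)
  case (1 S)
  then show ?case by simp
next
  case (2 S)
  have "of_int (S + 3) * (r - i) = ((r - i)^2 + 3) * (r - i)"
    using 2 by simp
  also have "\<dots> = r^3 - i^3 + 3 * (1 - r * i) * (r - i)"
    by algebra
  finally show ?case using ri by (simp add: numeral_3_eq_3)
next
  case (3 S j)
  let ?A = "r^(2*j+1)" and ?B = "i^(2*j+1)"
  have A: "r^(2*Suc j+1) = ?A * r^2" "i^(2*Suc j+1) = ?B * i^2"
      "r^(2*Suc (Suc j)+1) = ?A * r^4" "i^(2*Suc (Suc j)+1) = ?B * i^4"
    by (simp_all add: power_add[symmetric] eval_nat_numeral)
  have "of_int (lucasW S (Suc (Suc j))) * (r - i) =
     ((r - i)^2 + 2) * (of_int (lucasW S (Suc j)) * (r - i)) - of_int (lucasW S j) * (r - i)"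
    using 3 by (simp add: algebra_simps)
  also have "\<dots> = ((r - i)^2 + 2) * (?A * r^2 - ?B * i^2) - (?A - ?B)"
    unfolding 3(1)[OF 3(3)] 3(2)[OF 3(3)] A ..
  \<comment> \<open>The remainder is collected as a multiple of \<open>r * i - 1\<close>, which
    vanishes.\<close>
  also have "\<dots> = ?A * r^4 - ?B * i^4 +
      (r * i - 1) * (?A * (r * i + 1 - 2 * r^2) - ?B * (r * i + 1 - 2 * i^2))"
    by algebra
  also have "\<dots> = ?A * r^4 - ?B * i^4"
    by (simp add: ri)
  finally show ?case unfolding A .
qed

text \<open>Replacing \<theta> by (2 j + 1) \<theta> turns the parameter 4 sinh^2 \<theta> into
  \<open>S * (lucasW S j)^2\<close>, and the odd indices multiply: (2 j + 1) (2 k + 1) = 2 (j + k +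
  2 j k) + 1.\<close>

lemma lucasW_mult:
  assumes "S \<noteq> 0"
  shows "lucasW S (j + k + 2 * j * k) = lucasW S j * lucasW (S * (lucasW S j)^2) k"
proof -
  \<comment> \<open>\<open>s\<close> is 2 sinh \<theta> and \<open>u\<close> is 2 cosh \<theta>; the
    roots are complex because \<open>S\<close> may be negative.\<close>
  define s where "s = csqrt (of_int S)"
  define u where "u = csqrt (s^2 + 4)"
  define r where "r = (u + s) / 2"
  define i where "i = (u - s) / 2"
  have ri: "r * i = 1"
  proof -
    have "2 * r = u + s" "2 * i = u - s"
      by (simp_all add: r_def i_def field_simps)
    then have "4 * (r * i) = (u + s) * (u - s)" by algebra
    also have "\<dots> = u^2 - s^2" by algebra
    finally have "4 * (r * i) = u^2 - s^2" .
    then show ?thesis by (simp add: u_def)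
  qed
  have rs: "r - i = s"
    by (simp add: r_def i_def field_simps)
  have S: "(r - i)^2 = of_int S"
    by (simp add: rs s_def)
  have s0: "r - i \<noteq> 0"
    using assms S by auto
  note W1 = lucasW_closed_form[OF ri S]
  let ?m = "2 * j + 1"
  have ri': "r^?m * i^?m = 1"
    by (metis ri power_mult_distrib power_one)
  have S': "(r^?m - i^?m)^2 = of_int (S * (lucasW S j)^2)"
    using S unfolding W1[symmetric] by (simp add: power_mult_distrib)
  have e: "?m * (2 * k + 1) = 2 * (j + k + 2 * j * k) + 1"
    by (simp add: algebra_simps)
  have "of_int (lucasW (S * (lucasW S j)^2) k) * (r^?m - i^?m) = (r^?m)^(2*k+1) - (i^?m)^(2*k+1)"
    by (rule lucasW_closed_form[OF ri' S'])
  also have "\<dots> = r^(2 * (j + k + 2 * j * k) + 1) - i^(2 * (j + k + 2 * j * k) + 1)"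
    unfolding power_mult[symmetric] e ..
  also have "\<dots> = of_int (lucasW S (j + k + 2 * j * k)) * (r - i)"
    by (rule W1[symmetric])
  finally have "of_int (lucasW (S * (lucasW S j)^2) k) * of_int (lucasW S j) * (r - i) =
      of_int (lucasW S (j + k + 2 * j * k)) * (r - i)"
    unfolding W1[symmetric] by (simp add: mult.assoc)
  then have "(of_int (lucasW (S * (lucasW S j)^2) k * lucasW S j) :: complex) = of_int (lucasW S (j + k + 2 * j * k))"
    using s0 by simp
  then show ?thesis
    unfolding of_int_eq_iff by (simp add: mult.commute)
qed

text \<open>Expansion to first order in \<open>S\<close>, where \<open>D\<close> is the sum of the
  squares 1, 4, ..., j^2. At a prime index dividing \<open>S\<close> it decides divisibility by the
  square of that prime.\<close>

lemma lucasW_expand: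
  obtains D E where "lucasW S j = 2 * int j + 1 + S * D + S^2 * E"
    and "6 * D = int j * (int j + 1) * (2 * int j + 1)"
proof -
  have "\<exists>D E. lucasW S j = 2 * int j + 1 + S * D + S^2 * E \<and>
      6 * D = int j * (int j + 1) * (2 * int j + 1)"
  proof (induction S j rule: lucasW.induct)
    case (1 S)
    show ?case by (rule exI[of _ 0], rule exI[of _ 0]) simp
  next
    case (2 S)
    show ?case by (rule exI[of _ 1], rule exI[of _ 0]) simp
  next
    case (3 S j)
    then obtain D E D' E' where
      1: "lucasW S (Suc j) = 2 * int (Suc j) + 1 + S * D + S^2 * E"
         "6 * D = int (Suc j) * (int (Suc j) + 1) * (2 * int (Suc j) + 1)" and
      2: "lucasW S j = 2 * int j + 1 + S * D' + S^2 * E'"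
         "6 * D' = int j * (int j + 1) * (2 * int j + 1)"
      by auto
    show ?case
      \<comment> \<open>The witnesses come from sorting the recurrence by powers of
        \<open>S\<close>.\<close>
      apply (rule exI[of _ "2 * D - D' + 2 * int j + 3"], rule exI[of _ "2 * E - E' + D + S * E"])
      using 1(2) 2(2) by (simp add: 1(1) 2(1) algebra_simps power2_eq_square)
  qed
  then show ?thesis using that by blast
qed

lemma dvd_lucasW_iff:
  assumes "p dvd S"
  shows "p dvd lucasW S j \<longleftrightarrow> p dvd 2 * int j + 1"
proof -
  obtain D E where "lucasW S j = 2 * int j + 1 + S * D + S^2 * E" by (rule lucasW_expand)
  then have "lucasW S j = 2 * int j + 1 + S * (D + S * E)"
    by (simp add: algebra_simps power2_eq_square)
  with assms show ?thesis by (simp add: dvd_add_left_iff)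
qed

text \<open>The recurrence multiplies absolute values by at least
  \<open>\<bar>S + 2\<bar> - 1\<close>, hence by 4, once the sequence is increasing in absolute
  value; so the ratio bound is carried through the induction.\<close>

lemma lucasW_growth:
  assumes "\<bar>S + 2\<bar> \<ge> 5"
  shows "\<bar>lucasW S j\<bar> \<ge> 4^j"
proof -
  have "\<bar>lucasW S j\<bar> \<ge> 4^j \<and> \<bar>lucasW S (Suc j)\<bar> \<ge> 4 * \<bar>lucasW S j\<bar>"
  proof (induction j)
    case 0
    show ?case using assms by auto
  next
    case (Suc j)
    have "5 * \<bar>lucasW S (Suc j)\<bar> \<le> \<bar>S + 2\<bar> * \<bar>lucasW S (Suc j)\<bar>"
      using assms by (intro mult_right_mono) auto
    also have "\<dots> = \<bar>lucasW S (Suc (Suc j)) + lucasW S j\<bar>"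
      by (simp add: abs_mult)
    also have "\<dots> \<le> \<bar>lucasW S (Suc (Suc j))\<bar> + \<bar>lucasW S j\<bar>"
      by (rule abs_triangle_ineq)
    finally show ?case using Suc by auto
  qed
  then show ?thesis ..
qed

lemma prime_ge_5_int:
  fixes q :: int
  assumes "prime q" and "q \<noteq> 2" and "q \<noteq> 3"
  shows "q \<ge> 5"
proof -
  have "q \<noteq> 4"
  proof
    assume "q = 4"
    then have "(2::int) dvd q" by simp
    with assms show False using primes_dvd_imp_eq[OF two_is_prime_int] by metis
  qed
  moreover have "q \<ge> 2" using assms(1) by (rule prime_ge_2_int)
  ultimately show ?thesis using assms by linarith
qed

lemma only_prime_power:
  fixes w q :: int
  assumes "w \<noteq> 0" and "prime q" and "\<And>p. prime p \<Longrightarrow> p dvd w \<Longrightarrow> p = q"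
  obtains e where "\<bar>w\<bar> = q^e"
proof -
  obtain y where y: "w = q ^ multiplicity q w * y" "\<not> q dvd y"
    using assms(1,2) multiplicity_decompose'[of w q] by (metis not_prime_unit)
  have "is_unit y"
  proof (rule ccontr)
    assume "\<not> is_unit y"
    moreover have "y \<noteq> 0" using y assms(1) by auto
    ultimately obtain p where "prime p" "p dvd y"
      using prime_divisor_exists by blast
    then show False using assms(3)[of p] y by (metis dvd_mult)
  qed
  then have "\<bar>w\<bar> = \<bar>q ^ multiplicity q w\<bar>"
    using arg_cong[OF y(1), of abs] by (simp add: abs_mult)
  then show ?thesis
    using that prime_ge_0_int[OF assms(2)] by simp
qed

text \<open>
  The only prime that can divide the value at \<open>q = 2 j + 1\<close> is \<open>q\<close>, and \<open>q\<^sup>2\<close> does not divide it,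
  although its absolute value exceeds \<open>q\<close>.
\<close>

lemma no_large_prime:
  fixes q :: int
  assumes q: "prime q" "q \<ge> 5" "q dvd S" and S: "S \<noteq> 0" "S \<noteq> - 5"
    and j: "q = 2 * int j + 1"
    and primes: "\<And>p. prime p \<Longrightarrow> p dvd lucasW S j \<Longrightarrow> p dvd S"
  shows False
proof -
  have only: "p = q" if "prime p" "p dvd lucasW S j" for p
    using primes[OF that] dvd_lucasW_iff[of p S j] that q(1) j by (metis primes_dvd_imp_eq)
  have S5: "\<bar>S\<bar> \<ge> 5"
    using dvd_imp_le_int[OF S(1) q(3)] q(2) by simp
  \<comment> \<open>Among \<open>S\<close> with \<open>\<bar>S\<bar> \<ge> 5\<close>, the growth
    bound fails only for -5 and -6. The former is excluded by hypothesis, the latter has no prime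
    factor \<open>q \<ge> 5\<close>.\<close>
  have "S \<noteq> - 6"
  proof
    assume "S = - 6"
    then have "q dvd 2 * 3" using q(3) by simp
    then have "q dvd 2 \<or> q dvd 3" using q(1) prime_dvd_mult_iff by blast
    then have "q \<le> 3" by (auto dest: zdvd_imp_le)
    with q(2) show False by simp
  qed
  then have "\<bar>S + 2\<bar> \<ge> 5" using S S5 by linarith
  then have ge: "\<bar>lucasW S j\<bar> \<ge> 4^j" by (rule lucasW_growth)
  have "j \<ge> 2" using q(2) j by simp
  then have "(4::int)^j > 2 * int j + 1"
    by (induction j rule: dec_induct) auto
  with ge j have big: "\<bar>lucasW S j\<bar> > q" by simp
  then have "lucasW S j \<noteq> 0" using q(2) by auto
  then obtain e where e: "\<bar>lucasW S j\<bar> = q^e"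
    using only_prime_power[OF _ q(1)] only by blast
  have "e \<ge> 2"
  proof (rule ccontr)
    assume "\<not> e \<ge> 2"
    then have "e = 0 \<or> e = 1" by auto
    with e big q(2) show False by auto
  qed
  then have W2: "q^2 dvd lucasW S j"
    by (metis e dvd_abs_iff le_imp_power_dvd)
  obtain D E where W: "lucasW S j = q + S * D + S^2 * E"
    and D: "6 * D = int j * (int j + 1) * q"
    using lucasW_expand j by metis
  \<comment> \<open>As \<open>q\<close> is prime to 6, it divides \<open>D\<close>, so the value is
    congruent to \<open>q\<close> modulo \<open>q^2\<close>.\<close>
  have "q dvd 2 * (3 * D)"
    by (simp add: D)
  moreover have "\<not> q dvd 2" "\<not> q dvd 3" using q(2) by (auto dest: zdvd_imp_le)
  ultimately have "q dvd D" using prime_dvd_multD[OF q(1)] by blast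
  have "q^2 dvd S * D" using \<open>q dvd D\<close> q(3) by (simp add: power2_eq_square mult_dvd_mono)
  moreover have "q^2 dvd S^2 * E" using q(3) by (simp add: dvd_power_same)
  ultimately have "q^2 dvd q"
    using W2 unfolding W by (simp add: dvd_add_left_iff)
  then show False using q(2) by (auto dest: zdvd_imp_le simp: power2_eq_square)
qed

text \<open>A prime \<open>q\<close> dividing the value divides \<open>S\<close>, hence the odd
  index 2 j + 1, so the value at index \<open>q\<close> splits off by \<open>lucasW_mult\<close>.
  The value is not 0, since otherwise 2 would divide the odd index as well.\<close>

lemma prime_index_factor:
  fixes S :: int
  assumes S: "S \<noteq> 0" and "\<bar>lucasW S j\<bar> \<noteq> 1"
    and primes: "\<And>p. prime p \<Longrightarrow> p dvd lucasW S j \<Longrightarrow> p dvd S"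
  obtains q i k where "prime q" "q dvd S" "q = 2 * int i + 1"
    "lucasW S j = lucasW S i * lucasW (S * (lucasW S i)^2) k"
proof -
  have "\<not> is_unit (lucasW S j)" using assms(2) by simp
  moreover have "lucasW S j \<noteq> 0"
  proof
    assume 0: "lucasW S j = 0"
    then have "\<And>p::int. prime p \<Longrightarrow> p dvd 2 * int j + 1"
      using primes dvd_lucasW_iff by (metis dvd_0_right)
    then have "(2::int) dvd 2 * int j + 1"
      by (metis two_is_prime_int)
    then show False by presburger
  qed
  ultimately obtain q where q: "prime q" "q dvd lucasW S j"
    using prime_divisor_exists by blast
  then have qS: "q dvd S" by (rule primes)
  with q have qj: "q dvd 2 * int j + 1" using dvd_lucasW_iff by blast
  then obtain m where m: "2 * int j + 1 = q * m" by auto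
  have "odd (q * m)" unfolding m[symmetric] by simp
  then have odd: "odd q" "odd m" by auto
  have "q > 0" using q(1) by (rule prime_gt_0_int)
  then have "m > 0" using m by (smt (verit) zero_less_mult_pos of_nat_0_le_iff)
  define i k where "i = nat (q div 2)" and "k = nat (m div 2)"
  have i: "q = 2 * int i + 1" using odd \<open>q > 0\<close> by (simp add: i_def)
  have k: "m = 2 * int k + 1" using odd \<open>m > 0\<close> by (simp add: k_def)
  have "int j = int (i + k + 2 * i * k)"
    using m unfolding i k by (simp add: algebra_simps)
  then have "j = i + k + 2 * i * k" by (simp only: of_nat_eq_iff)
  then show ?thesis using that[OF q(1) qS i] lucasW_mult[OF S] by metis
qed

text \<open>The value is the product of the one at a prime index \<open>q\<close> and a second one
  with parameter \<open>S'\<close>; both inherit the condition on primes. For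
  \<open>q \<ge> 5\<close> only \<open>S = - 5\<close> is possible, for \<open>q = 3\<close> the
  first factor is \<open>S + 3\<close>. In both cases the second factor turns out to be a
  unit.\<close>

lemma lucasW_classification:
  fixes S :: int
  assumes S: "S \<noteq> 0" and W: "\<bar>lucasW S j\<bar> \<noteq> 1"
    and primes: "\<And>p. prime p \<Longrightarrow> p dvd lucasW S j \<Longrightarrow> p dvd S"
  shows "S = - 5 \<and> \<bar>lucasW S j\<bar> = 5 \<or>
    3 dvd S \<and> \<bar>lucasW S j\<bar> = \<bar>S + 3\<bar> \<and> (\<exists>e\<ge>1. \<bar>S + 3\<bar> = 3^e)"
proof -
  obtain q i k where q: "prime q" "q dvd S" "q = 2 * int i + 1"
    and Wj: "lucasW S j = lucasW S i * lucasW (S * (lucasW S i)^2) k"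
    by (rule prime_index_factor[OF assms])
  define S' where "S' = S * (lucasW S i)^2"
  have primes_i: "p dvd S" if "prime p" "p dvd lucasW S i" for p
    using primes that Wj by simp
  have primes_k: "p dvd S'" if "prime p" "p dvd lucasW S' k" for p
    using primes[OF that(1)] that Wj unfolding S'_def by simp
  have qWi: "q dvd lucasW S i"
    using dvd_lucasW_iff q by auto
  have "lucasW S i \<noteq> 0"
  proof
    assume "lucasW S i = 0"
    then have "(2::int) dvd S" using primes_i[OF two_is_prime_int] by simp
    then have "(2::int) dvd 2 * int i + 1" using dvd_lucasW_iff[of 2 S i] \<open>lucasW S i = 0\<close> by simp
    then show False by presburger
  qed
  then have S'0: "S' \<noteq> 0" using S by (simp add: S'_def)
  have "q \<noteq> 2" using q(3) by presburger
  then consider "q \<ge> 5" | "q = 3"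
    using prime_ge_5_int[OF q(1)] by blast
  then show ?thesis
  proof cases
    case 1
    then have S5: "S = - 5"
      using no_large_prime[OF q(1) _ q(2) S _ q(3) primes_i] by auto
    with q have "q dvd 5" by simp
    then have "q = 5" using 1 by (auto dest: zdvd_imp_le)
    then have "i = 2" using q(3) by simp
    have Wi: "lucasW S i = 5"
      unfolding \<open>i = 2\<close> S5 by (simp add: numeral_2_eq_2)
    have S'125: "S' = - 125" unfolding S'_def Wi by (simp add: S5)
    \<comment> \<open>Otherwise a prime index would split off again; it divides 125, so it is 5,
      which \<open>no_large_prime\<close> forbids for the parameter -125.\<close>
    have "\<bar>lucasW S' k\<bar> = 1"
    proof (rule ccontr)
      assume ne: "\<bar>lucasW S' k\<bar> \<noteq> 1"
      obtain q' i' k' where q': "prime q'" "q' dvd S'" "q' = 2 * int i' + 1"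
        and Wk: "lucasW S' k = lucasW S' i' * lucasW (S' * (lucasW S' i')^2) k'"
        by (rule prime_index_factor[OF S'0 ne primes_k])
      have "q' dvd 5^3" using q' S'125 by simp
      then have "q' dvd 5" using q'(1) prime_dvd_power by blast
      moreover have "prime (5::int)" using \<open>q = 5\<close> q(1) by simp
      ultimately have "q' = 5" using q'(1) primes_dvd_imp_eq by blast
      then show False
        using no_large_prime[OF q'(1) _ q'(2) S'0 _ q'(3)] primes_k Wk S'125 by simp
    qed
    then show ?thesis using S5 Wj Wi unfolding S'_def by (simp add: abs_mult)
  next
    case 2
    then have "i = 1" using q(3) by simp
    have Wi: "lucasW S i = S + 3" by (simp add: \<open>i = 1\<close>)
    have S3: "3 dvd S" using q 2 by simp
    have only3: "p = 3" if "prime p" "p dvd S + 3" for p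
    proof -
      have "p dvd S" using primes_i that Wi by simp
      then have "p dvd 3" using that(2) by (simp add: dvd_add_right_iff)
      then show ?thesis using primes_dvd_imp_eq that(1) q(1) 2 by blast
    qed
    have "prime (3::int)" using 2 q(1) by simp
    then obtain e where e: "\<bar>S + 3\<bar> = 3^e"
      using only_prime_power[of "S + 3" 3] only3 \<open>lucasW S i \<noteq> 0\<close> Wi by auto
    have "e \<noteq> 0"
    proof
      assume "e = 0"
      with e have "\<bar>S + 3\<bar> = 1" by simp
      then show False using S3 by presburger
    qed
    have S'9: "9 dvd S'"
    proof -
      have "3^2 dvd (S + 3)^2" using S3 by (intro dvd_power_same) simp
      then show ?thesis by (simp add: S'_def Wi)
    qed
    \<comment> \<open>A further prime index could only be 3, and then \<open>S' + 3\<close> would be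
      a power of 3 up to sign. Since 9 divides the nonzero \<open>S'\<close>, this is
      impossible.\<close>
    have "\<bar>lucasW S' k\<bar> = 1"
    proof (rule ccontr)
      assume ne: "\<bar>lucasW S' k\<bar> \<noteq> 1"
      obtain q' i' k' where q': "prime q'" "q' dvd S'" "q' = 2 * int i' + 1"
        and Wk: "lucasW S' k = lucasW S' i' * lucasW (S' * (lucasW S' i')^2) k'"
        by (rule prime_index_factor[OF S'0 ne primes_k])
      have primes': "p dvd S'" if "prime p" "p dvd lucasW S' i'" for p
        using primes_k that Wk by simp
      have "S' \<noteq> - 5" using S'9 by auto
      then have "\<not> q' \<ge> 5"
        using no_large_prime[OF q'(1) _ q'(2) S'0 _ q'(3)] primes' by blast
      then have "q' = 3"
        using prime_ge_5_int[OF q'(1)] q'(3) by presburger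
      then have Wi': "lucasW S' i' = S' + 3" using q'(3) by simp
      have only3': "p = 3" if "prime p" "p dvd S' + 3" for p
      proof -
        have "p dvd S'" using primes' that Wi' by simp
        then have "p dvd 3" using that(2) by (simp add: dvd_add_right_iff)
        then show ?thesis using primes_dvd_imp_eq that(1) \<open>prime 3\<close> by blast
      qed
      have "S' + 3 \<noteq> 0" using S'9 by presburger
      then obtain f where f: "\<bar>S' + 3\<bar> = 3^f"
        using only_prime_power[OF _ \<open>prime 3\<close>] only3' by blast
      have "\<not> 9 dvd \<bar>S' + 3\<bar>" using S'9 by presburger
      moreover have "9 dvd (3::int)^f" if "f \<ge> 2"
        using le_imp_power_dvd[OF that, of "3::int"] by simp
      ultimately have "f = 0 \<or> f = 1" using f by fastforce
      then show False using f S'9 S'0 by auto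
    qed
    then show ?thesis using S3 Wj Wi e \<open>e \<noteq> 0\<close> unfolding S'_def
      by (auto simp: abs_mult intro!: exI[of _ e])
  qed
qed

section \<open>Descent for Pell-type equations\<close>

text \<open>The companion \<open>cosh ((2 j + 1) \<theta>) / cosh \<theta>\<close> of \<^const>\<open>lucasW\<close>.\<close>

fun lucasU :: "int \<Rightarrow> nat \<Rightarrow> int" where
  "lucasU S 0 = 1"
| "lucasU S (Suc 0) = S + 1"
| "lucasU S (Suc (Suc j)) = (S + 2) * lucasU S (Suc j) - lucasU S j"

text \<open>Addition formulas for sinh and cosh with increment 2 \<theta>, where 2 cosh (2 \<theta>)
  = \<open>S + 2\<close> and 4 cosh^2 \<theta> = \<open>S + 4\<close>.\<close>

lemma lucasW_U_Suc:
  "2 * lucasW S (Suc j) = (S + 2) * lucasW S j + (S + 4) * lucasU S j"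
  "2 * lucasU S (Suc j) = (S + 2) * lucasU S j + S * lucasW S j"
proof -
  have "2 * lucasW S (Suc j) = (S + 2) * lucasW S j + (S + 4) * lucasU S j \<and>
    2 * lucasU S (Suc j) = (S + 2) * lucasU S j + S * lucasW S j"
  proof (induction j)
    case 0
    show ?case by simp
  next
    case (Suc j)
    then have W: "2 * lucasW S (Suc j) = (S + 2) * lucasW S j + (S + 4) * lucasU S j"
      and U: "2 * lucasU S (Suc j) = (S + 2) * lucasU S j + S * lucasW S j" by auto
    have "2 * ((S + 2) * lucasW S (Suc j)) = 2 * (2 * lucasW S j + (S + 4) * lucasU S (Suc j))"
      using W U by algebra
    moreover have "2 * ((S + 2) * lucasU S (Suc j)) = 2 * (2 * lucasU S j + S * lucasW S (Suc j))"
      using W U by algebra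
    ultimately have "(S + 2) * lucasW S (Suc j) = 2 * lucasW S j + (S + 4) * lucasU S (Suc j)"
      "(S + 2) * lucasU S (Suc j) = 2 * lucasU S j + S * lucasW S (Suc j)"
      by (simp_all only: mult_cancel_left) simp_all
    then show ?case unfolding lucasW.simps lucasU.simps by algebra
  qed
  then show "2 * lucasW S (Suc j) = (S + 2) * lucasW S j + (S + 4) * lucasU S j"
    "2 * lucasU S (Suc j) = (S + 2) * lucasU S j + S * lucasW S j" by auto
qed

text \<open>The same with increment -2 \<theta>: the matrix of the forward step has determinant
  \<open>(S + 2)^2 - S * (S + 4)\<close>, which is 4.\<close>

lemma lucasW_U_pred:
  "2 * lucasW S j = (S + 2) * lucasW S (Suc j) - (S + 4) * lucasU S (Suc j)"
  "2 * lucasU S j = (S + 2) * lucasU S (Suc j) - S * lucasW S (Suc j)"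
proof -
  have "2 * (2 * lucasW S j) = 2 * ((S + 2) * lucasW S (Suc j) - (S + 4) * lucasU S (Suc j))"
    "2 * (2 * lucasU S j) = 2 * ((S + 2) * lucasU S (Suc j) - S * lucasW S (Suc j))"
    using lucasW_U_Suc[of S j] by algebra+
  then show "2 * lucasW S j = (S + 2) * lucasW S (Suc j) - (S + 4) * lucasU S (Suc j)"
    "2 * lucasU S j = (S + 2) * lucasU S (Suc j) - S * lucasW S (Suc j)"
    by (simp_all only: mult_cancel_left) simp_all
qed

text \<open>
  In the application \<open>\<beta> = \<bar>b\<bar>\<close>, \<open>q = a x\<^sup>n\<close>, \<open>P\<close> is the absolute value of the denominator and \<open>d = sgn b \<cdot> c\<close>.
\<close>

locale pell_descent =
  fixes \<beta> P q t c d :: int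
  assumes pos: "\<beta> > 0" "P > 0" "q > 0" "t > 0"
    and P: "P = \<beta> * q * t^2 + d"
    and d: "d \<in> {1, -1, 2, -2, 4, -4}"
    and c: "c = d \<or> c = - d"
begin

definition sol :: "int \<Rightarrow> int \<Rightarrow> bool" where
  "sol y z \<longleftrightarrow> \<beta> * P * y^2 - q * z^2 = c"

text \<open>The bound on \<open>y\<close> that results when the descent step fails to make
  \<open>\<bar>z\<bar>\<close> smaller; which alternative occurs depends on the sign of
  \<open>c\<close> relative to \<open>d\<close>.\<close>

definition reduced :: "int \<Rightarrow> bool" where
  "reduced y \<longleftrightarrow> (c = d \<and> \<beta> * y^2 \<le> 1) \<or> (c = - d \<and> P * y^2 \<le> q * t^2)"

lemma d_nonzero: "d \<noteq> 0"
  using d by auto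

lemma sol_abs: "sol \<bar>y\<bar> \<bar>z\<bar> \<longleftrightarrow> sol y z"
  by (simp add: sol_def)

text \<open>Makes the division by \<open>d\<close> in the descent exact. For \<open>d\<close> = 4 or
  -4 the equation is read modulo 2, where \<open>P\<close> and \<open>\<beta> * q * t^2\<close>
  agree; otherwise \<open>d\<close> divides 2.\<close>

lemma integrality:
  assumes "sol y z"
  shows "d dvd 2 * P * (z - t * \<beta> * y)" "d dvd 2 * (P * y - t * q * z)"
proof -
  have "d dvd 2 * P * (z - t * \<beta> * y) \<and> d dvd 2 * (P * y - t * q * z)"
  proof (cases "d = 4 \<or> d = -4")
    case True
    then have "even d" "even c" using c by auto
    have "even (\<beta> * P * y^2 - q * z^2)"
      using assms \<open>even c\<close> by (simp add: sol_def)
    moreover have "even P \<longleftrightarrow> even (\<beta> * q * t^2)"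
      using P \<open>even d\<close> by simp
    ultimately have "even (P * (z - t * \<beta> * y))" "even (P * y - t * q * z)"
      by auto
    then have "2 * 2 dvd 2 * (P * (z - t * \<beta> * y))" "2 * 2 dvd 2 * (P * y - t * q * z)"
      by (blast intro: mult_dvd_mono dvd_refl)+
    then show ?thesis using True by (auto simp: mult.assoc)
  next
    case False
    then have "d dvd 2" using d by auto
    then show ?thesis by (simp add: dvd_mult2)
  qed
  then show "d dvd 2 * P * (z - t * \<beta> * y)" "d dvd 2 * (P * y - t * q * z)" by auto
qed

text \<open>
  The new solution arises by division by the unit \<open>(\<surd>P + t \<surd>(\<beta> q))\<^sup>2 / d\<close> of norm 1.
\<close>

lemma descent_step:
  assumes sol: "sol y z" and nonneg: "y \<ge> 0" "z \<ge> 0" and "\<not> reduced y"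
  obtains y' z' where "sol y' z'" "\<bar>z'\<bar> < z"
    "d * (z + z') = 2 * P * (z - t * \<beta> * y)" "d * (y + y') = 2 * (P * y - t * q * z)"
proof -
  obtain m k where m: "2 * P * (z - t * \<beta> * y) = d * m" and k: "2 * (P * y - t * q * z) = d * k"
    using integrality[OF sol] by (metis dvdE)
  define z' y' where "z' = m - z" and "y' = k - y"
  have eq: "\<beta> * P * y^2 - q * z^2 = c" using sol by (simp add: sol_def)
  then have qz: "q * z^2 = \<beta> * P * y^2 - c" by simp
  have qt: "\<beta> * q * t^2 = P - d" using P by simp
  have z': "d * (z + z') = 2 * P * (z - t * \<beta> * y)"
    and y': "d * (y + y') = 2 * (P * y - t * q * z)"
    using m k unfolding z'_def y'_def by simp_all
  have "d^2 * (\<beta> * P * y'^2 - q * z'^2) = d^2 * c"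
  proof -
    have 1: "d * z' = 2 * P * (z - t * \<beta> * y) - d * z"
      and 2: "d * y' = 2 * (P * y - t * q * z) - d * y"
      using z' y' by (simp_all add: algebra_simps)
    have "d^2 * (\<beta> * P * y'^2 - q * z'^2) = \<beta> * P * (d * y')^2 - q * (d * z')^2"
      by algebra
    also have "\<dots> = d^2 * (\<beta> * P * y^2 - q * z^2)"
      unfolding 1 2 P by algebra
    finally show ?thesis by (simp add: eq)
  qed
  then have sol': "sol y' z'" using d_nonzero by (simp add: sol_def)
  have "\<bar>z'\<bar> < z"
  proof (rule ccontr)
    assume "\<not> \<bar>z'\<bar> < z"
    \<comment> \<open>The first failure bounds \<open>d * (z - t * \<beta> * y)\<close>, the second
      \<open>d * (q * t * z - P * y)\<close>. Multiplying by a multiple of the conjugate factor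
      produces squares, and \<open>qz\<close> and \<open>qt\<close> then eliminate \<open>z\<close>,
      leaving a bound on \<open>y\<close>.\<close>
    then consider "z' \<le> - z" | "z' \<ge> z" by linarith
    then have "reduced y"
    proof cases
      case 1
      have "2 * P * (d * (z - t * \<beta> * y)) = d^2 * (z + z')"
        using z' by algebra
      also have "\<dots> \<le> 0" using 1 by (simp add: mult_nonneg_nonpos)
      finally have "d * (z - t * \<beta> * y) \<le> 0"
        using pos mult_pos_pos[of "2 * P" "d * (z - t * \<beta> * y)"] by linarith
      moreover have "q * (z + t * \<beta> * y) \<ge> 0" using pos nonneg by simp
      ultimately have "d * (z - t * \<beta> * y) * (q * (z + t * \<beta> * y)) \<le> 0"
        by (rule mult_nonpos_nonneg)
      also have "d * (z - t * \<beta> * y) * (q * (z + t * \<beta> * y)) =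
          d * (q * z^2 - \<beta> * y^2 * (\<beta> * q * t^2))"
        by algebra
      also have "\<dots> = d * (\<beta> * d * y^2 - c)"
        unfolding qz qt by algebra
      finally have le: "d * (\<beta> * d * y^2 - c) \<le> 0" .
      have d2: "d^2 > 0" using d_nonzero by simp
      from c show ?thesis
      proof
        assume "c = d"
        then have "d^2 * (\<beta> * y^2 - 1) \<le> 0" using le by (simp add: algebra_simps power2_eq_square)
        then have "\<beta> * y^2 \<le> 1" using d2 by (simp add: mult_le_0_iff)
        then show ?thesis using \<open>c = d\<close> unfolding reduced_def by blast
      next
        assume "c = - d"
        then have "d^2 * (\<beta> * y^2 + 1) \<le> 0" using le by (simp add: algebra_simps power2_eq_square)
        moreover have "\<beta> * y^2 \<ge> 0" using pos by simp
        ultimately show ?thesis using d2 by (simp add: mult_le_0_iff)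
      qed
    next
      case 2
      have "2 * \<beta> * t * (d * (q * t * z - P * y)) = d * (2 * P * (z - t * \<beta> * y)) - 2 * (d^2 * z)"
        using P by algebra
      also have "\<dots> = d^2 * (z' - z)"
        using z' by algebra
      finally have "2 * \<beta> * t * (d * (q * t * z - P * y)) \<ge> 0"
        using 2 by simp
      moreover have "2 * \<beta> * t > 0" using pos by simp
      ultimately have "d * (q * t * z - P * y) \<ge> 0"
        using mult_pos_neg[of "2 * \<beta> * t"] by (meson not_less)
      moreover have "q * t * z + P * y \<ge> 0" using pos nonneg by simp
      ultimately have "d * (q * t * z - P * y) * (q * t * z + P * y) \<ge> 0"
        by (rule mult_nonneg_nonneg)
      also have "d * (q * t * z - P * y) * (q * t * z + P * y) =
          d * (q * t^2 * (q * z^2) - P^2 * y^2)"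
        by algebra
      also have "\<dots> = d * (P * y^2 * (\<beta> * q * t^2) - c * q * t^2 - P^2 * y^2)"
        unfolding qz by algebra
      also have "\<dots> = - (d * (d * P * y^2 + c * q * t^2))"
        unfolding qt by algebra
      finally have le: "d * (d * P * y^2 + c * q * t^2) \<le> 0" by simp
      have d2: "d^2 > 0" using d_nonzero by simp
      have qt2: "q * t^2 > 0" using pos by simp
      from c show ?thesis
      proof
        assume "c = d"
        then have "d^2 * (P * y^2 + q * t^2) \<le> 0" using le by (simp add: algebra_simps power2_eq_square)
        moreover have "P * y^2 \<ge> 0" using pos by simp
        ultimately show ?thesis using d2 qt2 by (simp add: mult_le_0_iff)
      next
        assume "c = - d"
        then have "d^2 * (P * y^2 - q * t^2) \<le> 0" using le by (simp add: algebra_simps power2_eq_square)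
        then have "P * y^2 \<le> q * t^2" using d2 by (simp add: mult_le_0_iff)
        then show ?thesis using \<open>c = - d\<close> unfolding reduced_def by blast
      qed
    qed
    with assms show False by blast
  qed
  with that sol' z' y' show ?thesis by blast
qed

text \<open>Well-founded induction on \<open>\<bar>z\<bar>\<close>. The absolute values renormalise
  the signs, because \<open>y'\<close> and \<open>z'\<close> may be negative.\<close>

lemma descent_induct [consumes 1, case_names reduced step]:
  fixes R :: "int \<Rightarrow> int \<Rightarrow> bool"
  assumes "sol y z"
    and red: "\<And>y z. sol y z \<Longrightarrow> y \<ge> 0 \<Longrightarrow> z \<ge> 0 \<Longrightarrow> reduced y \<Longrightarrow> R y z"
    and step: "\<And>y z y' z'. y \<ge> 0 \<Longrightarrow> z \<ge> 0 \<Longrightarrow> d * (z + z') = 2 * P * (z - t * \<beta> * y) \<Longrightarrow>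
      d * (y + y') = 2 * (P * y - t * q * z) \<Longrightarrow> R \<bar>y'\<bar> \<bar>z'\<bar> \<Longrightarrow> R y z"
  shows "R \<bar>y\<bar> \<bar>z\<bar>"
  using assms(1)
proof (induction "nat \<bar>z\<bar>" arbitrary: y z rule: less_induct)
  case less
  then have sol: "sol \<bar>y\<bar> \<bar>z\<bar>" by (simp add: sol_abs)
  show ?case
  proof (cases "reduced \<bar>y\<bar>")
    case True
    with sol show ?thesis by (intro red) auto
  next
    case False
    obtain y' z' where s: "sol y' z'" "\<bar>z'\<bar> < \<bar>z\<bar>"
      and e: "d * (\<bar>z\<bar> + z') = 2 * P * (\<bar>z\<bar> - t * \<beta> * \<bar>y\<bar>)"
        "d * (\<bar>y\<bar> + y') = 2 * (P * \<bar>y\<bar> - t * q * \<bar>z\<bar>)"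
      by (rule descent_step[OF sol _ _ False]) auto
    have "R \<bar>y'\<bar> \<bar>z'\<bar>" using s by (intro less.hyps) auto
    then show ?thesis by (intro step[OF _ _ e]) auto
  qed
qed

text \<open>If \<open>d\<close> divides \<open>P\<close>, then \<open>z + z'\<close> is twice an
  integer: the parity of \<open>z\<close> is an invariant of the descent.\<close>

lemma step_parity:
  assumes "d * (z + z') = 2 * P * (z - t * \<beta> * y)" and "d dvd P"
  shows "even (z - z0) \<longleftrightarrow> even (\<bar>z'\<bar> - z0)"
proof -
  obtain p where "P = d * p" using assms(2) by auto
  with assms(1) d_nonzero have "z + z' = 2 * (p * (z - t * \<beta> * y))"
    by simp
  then have "even (z + z')" by simp
  then show ?thesis by auto
qed

lemma reduced_solution:
  assumes "sol y z"
  obtains y0 z0 where "sol y0 z0" "y0 \<ge> 0" "z0 \<ge> 0" "reduced y0" "d dvd P \<Longrightarrow> even (z - z0)"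
proof -
  define R :: "int \<Rightarrow> int \<Rightarrow> bool" where "R = (\<lambda>y z. \<exists>y0 z0. sol y0 z0 \<and> y0 \<ge> 0 \<and> z0 \<ge> 0 \<and> reduced y0 \<and>
    (d dvd P \<longrightarrow> even (z - z0)))"
  from assms have "R \<bar>y\<bar> \<bar>z\<bar>"
  proof (induction rule: descent_induct)
    case (reduced y z)
    then show ?case unfolding R_def by (intro exI[of _ y] exI[of _ z]) auto
  next
    case (step y z y' z')
    then show ?case unfolding R_def using step_parity[OF step(3)] by blast
  qed
  then obtain y0 z0 where "sol y0 z0" "y0 \<ge> 0" "z0 \<ge> 0" "reduced y0" "d dvd P \<longrightarrow> even (\<bar>z\<bar> - z0)"
    unfolding R_def by blast
  with that show ?thesis by auto
qed

text \<open>For \<open>c = d\<close> a reduced solution has \<open>y = 0\<close>, which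
  \<open>no0\<close> rules out by parity, or is \<open>(1, t)\<close> with
  \<open>\<beta> = 1\<close>. Undoing the descent from \<open>(1, t)\<close> yields the pairs of
  \<open>lucasU\<close> and \<open>t\<close> times \<open>lucasW\<close>, up to signs.\<close>

lemma solution_in_orbit:
  assumes "sol y z" and "c = d" and S: "S * d = 4 * q * t^2"
    and no0: "\<And>z0. q * z0^2 = - d \<Longrightarrow> d dvd P \<and> odd (z - z0)"
  shows "\<beta> = 1 \<and> (\<exists>j. \<bar>z\<bar> = t * \<bar>lucasW S j\<bar>)"
proof -
  \<comment> \<open>The first alternative records a descent ending at \<open>y = 0\<close> and the
    parity it transports; it is refuted only at the end, for the original \<open>z\<close>.\<close>
  define R :: "int \<Rightarrow> int \<Rightarrow> bool" where "R = (\<lambda>y z.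
    (\<exists>z0. q * z0^2 = - d \<and> (d dvd P \<longrightarrow> even (z - z0))) \<or>
    \<beta> = 1 \<and> (\<exists>j. y = \<bar>lucasU S j\<bar> \<and> z = t * \<bar>lucasW S j\<bar>))"
  from assms(1) have "R \<bar>y\<bar> \<bar>z\<bar>"
  proof (induction rule: descent_induct)
    case (reduced y z)
    then have le: "\<beta> * y^2 \<le> 1" and eq: "\<beta> * P * y^2 - q * z^2 = d"
      using reduced(1)[unfolded sol_def] reduced(4)[unfolded reduced_def] \<open>c = d\<close> d_nonzero by auto
    show ?case
    proof (cases "y = 0")
      case True
      then have "q * z^2 = - d" using eq by simp
      then show ?thesis unfolding R_def by auto
    next
      case False
      then have "y^2 > 0" by simp
      then have "y^2 \<ge> 1" by linarith
      then have "\<beta> * y^2 \<ge> \<beta> * 1" "\<beta> * y^2 \<ge> 1 * y^2"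
        using pos by (intro mult_mono; simp)+
      then have "\<beta> = 1" "y^2 = 1" using le pos \<open>y^2 > 0\<close> by linarith+
      then have "y = 1" using \<open>y \<ge> 0\<close> by (simp add: power2_eq_1_iff)
      have "q * t^2 = q * z^2" using eq P unfolding \<open>\<beta> = 1\<close> \<open>y = 1\<close>
        by (simp only: power_one mult_1_left mult_1_right)
      then have "z^2 = t^2" using pos by (simp only: mult_cancel_left) simp
      then have "z = t" using pos \<open>z \<ge> 0\<close> by (simp add: power2_eq_iff)
      then show ?thesis unfolding R_def using \<open>\<beta> = 1\<close> \<open>y = 1\<close>
        by (intro disjI2 conjI exI[of _ 0]) auto
    qed
  next
    case (step y z y' z')
    from \<open>R \<bar>y'\<bar> \<bar>z'\<bar>\<close> consider
      (0) z0 where "q * z0^2 = - d" "d dvd P \<longrightarrow> even (\<bar>z'\<bar> - z0)" |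
      (orbit) j where "\<beta> = 1" "\<bar>y'\<bar> = \<bar>lucasU S j\<bar>" "\<bar>z'\<bar> = \<bar>t * lucasW S j\<bar>"
      unfolding R_def using pos by (auto simp: abs_mult)
    then show ?case
    proof cases
      case 0
      then show ?thesis unfolding R_def using step_parity[OF step(3)] by blast
    next
      case orbit
      \<comment> \<open>Only absolute values are known. Equal signs raise the index by one, opposite
        signs lower it, and from index 0 opposite signs lead back to index 0.\<close>
      obtain \<sigma> where \<sigma>: "\<sigma> = 1 \<or> \<sigma> = - 1" "y' = \<sigma> * lucasU S j"
        using orbit(2) by (metis abs_eq_iff mult_1 mult_minus_left)
      obtain \<tau> where \<tau>: "\<tau> = 1 \<or> \<tau> = - 1" "z' = \<tau> * (t * lucasW S j)"
        using orbit(3) by (metis abs_eq_iff mult_1 mult_minus_left)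
      have "d * (2 * z) = d * ((S + 2) * z' + (S + 4) * t * y')"
        using step(3,4) P S orbit(1) by algebra
      then have "2 * z = (S + 2) * z' + (S + 4) * t * y'"
        using d_nonzero by (simp only: mult_cancel_left) simp
      then have z: "2 * z = t * (\<tau> * ((S + 2) * lucasW S j) + \<sigma> * ((S + 4) * lucasU S j))"
        unfolding \<sigma>(2) \<tau>(2) by algebra
      have "d * (2 * y) = d * ((S + 2) * y' + S * (\<tau> * lucasW S j))"
        using step(3,4) P S orbit(1) \<tau>(2) by algebra
      then have "2 * y = (S + 2) * y' + S * (\<tau> * lucasW S j)"
        using d_nonzero by (simp only: mult_cancel_left) simp
      then have y: "2 * y = \<sigma> * ((S + 2) * lucasU S j) + \<tau> * (S * lucasW S j)"
        unfolding \<sigma>(2) by algebra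
      have "\<exists>i. \<bar>y\<bar> = \<bar>lucasU S i\<bar> \<and> \<bar>z\<bar> = \<bar>t * lucasW S i\<bar>"
      proof (cases "\<sigma> = \<tau>")
        case True
        have "2 * z = 2 * (\<tau> * (t * lucasW S (Suc j)))"
          using z True lucasW_U_Suc(1)[of S j] by algebra
        moreover have "2 * y = 2 * (\<tau> * lucasU S (Suc j))"
          using y True lucasW_U_Suc(2)[of S j] by algebra
        ultimately show ?thesis using \<tau>(1) by (intro exI[of _ "Suc j"]) auto
      next
        case False
        then have \<sigma>\<tau>: "\<tau> = - \<sigma>" using \<sigma>(1) \<tau>(1) by auto
        show ?thesis
        proof (cases j)
          case 0
          then show ?thesis using y z \<sigma>\<tau> \<sigma>(1) by (intro exI[of _ 0]) (auto simp: algebra_simps)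
        next
          case (Suc i)
          have "2 * z = \<tau> * t * ((S + 2) * lucasW S (Suc i) - (S + 4) * lucasU S (Suc i))"
            using z by (simp add: \<sigma>\<tau> Suc algebra_simps del: lucasW.simps lucasU.simps)
          then have z2: "2 * z = 2 * (\<tau> * (t * lucasW S i))"
            unfolding lucasW_U_pred(1)[symmetric] by algebra
          have "2 * y = \<sigma> * ((S + 2) * lucasU S (Suc i) - S * lucasW S (Suc i))"
            using y by (simp add: \<sigma>\<tau> Suc algebra_simps del: lucasW.simps lucasU.simps)
          then have y2: "2 * y = 2 * (\<sigma> * lucasU S i)"
            unfolding lucasW_U_pred(2)[symmetric] by algebra
          show ?thesis using y2 z2 \<tau>(1) \<sigma>(1) by (intro exI[of _ i]) auto
        qed
      qed
      then show ?thesis unfolding R_def using orbit(1) step(1,2) pos by (auto simp: abs_mult)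
    qed
  qed
  moreover have "\<not> (q * z0^2 = - d \<and> (d dvd P \<longrightarrow> even (\<bar>z\<bar> - z0)))" for z0
    using no0[of z0] by auto
  ultimately show ?thesis unfolding R_def by blast
qed

end

section \<open>Auxiliary Diophantine equations and the families with x = 3\<close>

lemma odd_dvd_power_two:
  fixes u :: int
  assumes "odd u" and "u dvd 2^k"
  shows "\<bar>u\<bar> = 1"
proof -
  have "coprime u (2^k)" using assms(1) by simp
  then have "is_unit u" using assms(2) by (meson coprime_common_divisor dvd_refl)
  then show ?thesis by simp
qed

text \<open>With \<open>\<bar>y\<bar> = 2 * s + 1\<close> the equation reads
  \<open>w^2 = 2 * (s * (s + 1))\<close>. The odd one of \<open>s\<close> and \<open>s + 1\<close>
  divides a power of 2, hence is 1, and so \<open>s = 1\<close>.\<close>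

lemma pell_two_power:
  fixes y w :: int
  assumes eq: "y^2 - 2 * w^2 = 1" and "w > 0" and "w dvd 2^k"
  shows "w = 2 \<and> \<bar>y\<bar> = 3"
proof -
  have "y^2 = 2 * w^2 + 1" using eq by simp
  then have "odd (y^2)" by simp
  then have "odd \<bar>y\<bar>" by simp
  then obtain s where s: "\<bar>y\<bar> = 2 * s + 1" by (rule oddE)
  have "(2 * s + 1)^2 = 1 + 2 * w^2"
    using eq by (simp add: s[symmetric])
  then have w2: "w^2 = 2 * (s * (s + 1))"
    by (simp add: power2_eq_square algebra_simps)
  have "s \<noteq> 0" using w2 \<open>w > 0\<close> by auto
  then have "s \<ge> 1" using s by linarith
  have dvd: "u dvd 2^(k * 2)" if "u dvd s * (s + 1)" for u
  proof -
    have "u dvd w^2" using that w2 by simp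
    also have "w^2 dvd (2^k)^2" using assms(3) by (rule dvd_power_same)
    finally show ?thesis by (simp add: power_mult)
  qed
  have "s = 1"
  proof (cases "even s")
    case True
    then have "\<bar>s + 1\<bar> = 1" by (intro odd_dvd_power_two[OF _ dvd]) auto
    with \<open>s \<ge> 1\<close> show ?thesis by simp
  next
    case False
    then have "\<bar>s\<bar> = 1" by (intro odd_dvd_power_two[OF _ dvd]) auto
    with \<open>s \<ge> 1\<close> show ?thesis by simp
  qed
  then have "w^2 = 2^2" using w2 by simp
  then have "w = 2" using \<open>w > 0\<close> unfolding power2_eq_iff by simp
  then show ?thesis using s \<open>s = 1\<close> by simp
qed

lemma small_square_difference:
  fixes t z :: int
  assumes "t^2 - z^2 = k" and "t > 0" and "z \<ge> 0" and "k \<in> {1, 2, 4}"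
  shows "k = 1 \<and> t = 1 \<or> k = 4 \<and> t = 2"
proof -
  have k: "(t - z) * (t + z) = k" using assms(1) by (simp add: algebra_simps power2_eq_square)
  then have "(t - z) * (t + z) > 0" using assms(4) by auto
  then have "t - z > 0" using assms(2,3) by (simp add: zero_less_mult_iff)
  then have "1 * (t + z) \<le> (t - z) * (t + z)" using assms(2,3) by (intro mult_right_mono) auto
  then have "t + z \<le> 4" using k assms(4) by auto
  then have "t \<in> {1, 2, 3, 4}" "z \<in> {0, 1, 2, 3}" using assms(2,3) by auto
  then show ?thesis using assms(1,4) by auto
qed

text \<open>Describes a solution with \<open>y = 0\<close>. As \<open>a\<close> divides
  \<open>c\<close> and is prime to it, \<open>a = 1\<close>; then \<open>x^n * z0^2 \<le> 4\<close>
  forces \<open>z0^2 = 1\<close> and \<open>x^n = - c\<close>. The parities contradict those of the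
  descent.\<close>

lemma zero_solution:
  fixes a c x z0 :: int
  assumes c: "c \<in> {1, -1, 2, -2, 4, -4}" and "x > 1" and "n > 0" and "a > 0" and g: "gcd a c = 1"
    and eq: "a * x^n * z0^2 = - c"
  shows "even x" and "c dvd a * x^n" and "odd z0"
proof -
  have "a dvd - c" unfolding eq[symmetric] by (simp add: mult.assoc)
  then have "a dvd gcd a c" by simp
  then have "a = 1" using g \<open>a > 0\<close> by simp
  have "x^1 \<le> x^n" using assms by (intro power_increasing) auto
  then have X: "x^n \<ge> 2" using \<open>x > 1\<close> by simp
  have z2: "x^n * z0^2 = - c" using eq \<open>a = 1\<close> by simp
  then have "z0 \<noteq> 0" using c by auto
  then have "z0^2 > 0" by simp
  then have "z0^2 \<ge> 1" by linarith
  have "x^n * 1 \<le> x^n * z0^2" using X \<open>z0^2 \<ge> 1\<close> by (intro mult_left_mono) auto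
  moreover have "2 * z0^2 \<le> x^n * z0^2" using X by (intro mult_right_mono) auto
  ultimately have "x^n \<le> 4" "z0^2 \<le> 2" using z2 c by auto
  have "\<bar>z0\<bar> = 1"
  proof (rule ccontr)
    assume "\<bar>z0\<bar> \<noteq> 1"
    then have "\<bar>z0\<bar> \<ge> 2" using \<open>z0 \<noteq> 0\<close> by linarith
    then have "\<bar>z0\<bar>^2 \<ge> 2^2" by (intro power_mono) auto
    with \<open>z0^2 \<le> 2\<close> show False by simp
  qed
  then show "odd z0" by presburger
  have "z0^2 = 1" using \<open>\<bar>z0\<bar> = 1\<close> by (simp add: abs_square_eq_1)
  then have "x^n = - c" using z2 by simp
  then show "c dvd a * x^n" by simp
  have "even (x^n)" using \<open>x^n = - c\<close> X c by auto
  then show "even x" by simp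
qed

section \<open>Integral form of the equation and the families with x = 3\<close>

lemma equation_holds_iff:
  "equation_holds a b x y n t l c \<longleftrightarrow>
    a * b * t^2 * x^n + c \<noteq> 0 \<and>
    a * x^n * (x^l)^2 + c = b * y^2 * (a * b * t^2 * x^n + c)"
proof -
  have "(of_int (a * x^(n + 2*l) + c) :: rat) / of_int (a * b * t^2 * x^n + c) = of_int (b * y^2)
    \<longleftrightarrow> a * x^(n + 2*l) + c = b * y^2 * (a * b * t^2 * x^n + c)"
    if "a * b * t^2 * x^n + c \<noteq> 0"
  proof -
    have "(of_int (a * b * t^2 * x^n + c) :: rat) \<noteq> 0"
      using that by (simp only: of_int_eq_0_iff) simp
    then have "(of_int (a * x^(n + 2*l) + c) :: rat) / of_int (a * b * t^2 * x^n + c) = of_int (b * y^2)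
      \<longleftrightarrow> (of_int (a * x^(n + 2*l) + c) :: rat) = of_int (b * y^2) * of_int (a * b * t^2 * x^n + c)"
      by (rule nonzero_divide_eq_eq)
    also have "\<dots> \<longleftrightarrow> a * x^(n + 2*l) + c = b * y^2 * (a * b * t^2 * x^n + c)"
      by (simp only: of_int_mult[symmetric] of_int_eq_iff)
    finally show ?thesis .
  qed
  moreover have "a * x^(n + 2*l) = a * x^n * (x^l)^2"
    by (simp add: power_add power_mult[symmetric] mult.commute[of 2 l] mult.assoc)
  ultimately show ?thesis unfolding equation_holds_def by metis
qed

lemma three_power_mod_4: "(3::int)^k mod 4 = (if even k then 1 else 3)"
proof (induction k)
  case (Suc k)
  have "(3::int)^Suc k mod 4 = (3 * (3^k mod 4)) mod 4"
    by (simp add: mod_mult_right_eq)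
  then show ?case using Suc by simp
qed simp

text \<open>Frees the list from rational quotients and from the two signs of \<open>y\<close>, so
  that integer arithmetic applies.\<close>

lemma listed_bt1_iff:
  fixes a x y c m :: int
  assumes "l > 0" and m: "m = 3^(l - 1)"
  shows "listed_bt1 a x y n l c \<longleftrightarrow>
    x = 3 \<and> n = 1 \<and>
      (c = -1 \<and> even l \<and> 4 * a = m + 1 \<and> \<bar>y\<bar> = 3 * m + 2 \<or>
       c = 1 \<and> odd l \<and> 4 * a = m - 1 \<and> \<bar>y\<bar> = 3 * m - 2 \<or>
       c = -2 \<and> odd l \<and> 2 * a = m + 1 \<and> \<bar>y\<bar> = 3 * m + 2 \<or>
       c = 2 \<and> even l \<and> 2 * a = m - 1 \<and> \<bar>y\<bar> = 3 * m - 2) \<or>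
    c = -4 \<and> l = 1 \<and> n = 1 \<and> a = 1 \<and> x = 5 \<and> \<bar>y\<bar> = 11"
proof -
  have l: "(3::int)^l = 3 * m" using \<open>l > 0\<close> by (simp add: m power_eq_if)
  have "m \<ge> 1" by (simp add: m)
  have pow: "(3::rat)^(l - 1) = of_int m" by (simp add: m)
  have div: "(of_int a = (of_int m + 1 :: rat) / 4) = (4 * a = m + 1)"
    "(of_int a = (of_int m - 1 :: rat) / 4) = (4 * a = m - 1)"
    "(of_int a = (of_int m + 1 :: rat) / 2) = (2 * a = m + 1)"
    "(of_int a = (of_int m - 1 :: rat) / 2) = (2 * a = m - 1)"
  proof -
    have "rat_of_int a = r / k \<longleftrightarrow> k * rat_of_int a = r" if "k \<noteq> 0" for r k
      using that by (auto simp: field_simps)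
    note quot = this[of 4] this[of 2]
    have "(4 * rat_of_int a = of_int m + 1) = (rat_of_int (4 * a) = of_int (m + 1))"
      "(4 * rat_of_int a = of_int m - 1) = (rat_of_int (4 * a) = of_int (m - 1))"
      "(2 * rat_of_int a = of_int m + 1) = (rat_of_int (2 * a) = of_int (m + 1))"
      "(2 * rat_of_int a = of_int m - 1) = (rat_of_int (2 * a) = of_int (m - 1))"
      by simp_all
    then show "(of_int a = (of_int m + 1 :: rat) / 4) = (4 * a = m + 1)"
      "(of_int a = (of_int m - 1 :: rat) / 4) = (4 * a = m - 1)"
      "(of_int a = (of_int m + 1 :: rat) / 2) = (2 * a = m + 1)"
      "(of_int a = (of_int m - 1 :: rat) / 2) = (2 * a = m - 1)"
      by (simp_all only: quot of_int_eq_iff)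
  qed
  have y: "(y = 3 * m + 2 \<or> y = - (3 * m + 2)) = (\<bar>y\<bar> = 3 * m + 2)"
    "(y = 3 * m - 2 \<or> y = - (3 * m - 2)) = (\<bar>y\<bar> = 3 * m - 2)"
    "(y = 11 \<or> y = - 11) = (\<bar>y\<bar> = 11)"
    using \<open>m \<ge> 1\<close> by linarith+
  show ?thesis unfolding listed_bt1_def l pow div y
    by (intro iffI; elim disjE conjE; simp)
qed

text \<open>One identity for all four families with \<open>x = 3\<close>; \<open>s\<close> is the
  sign of \<open>c\<close> and \<open>k\<close> its absolute value there. The cubic
  \<open>27 * m^2 * (m - s) + 4 * s\<close> has the double root 2 s / 3.\<close>

lemma three_family_identity:
  fixes a c k m s :: int
  assumes "s^2 = 1" and "c = s * k" and "4 * a = k * (m - s)"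
  shows "a * 3 * (3 * m)^2 + c = (3 * m - 2 * s)^2 * (a * 3 + c)"
proof -
  have "4 * (a * 3 * (3 * m)^2 + c) = 27 * m^2 * (4 * a) + 4 * c"
    by algebra
  also have "\<dots> = k * (27 * m^2 * (m - s) + 4 * s)"
    unfolding assms(2,3) by algebra
  also have "\<dots> = k * ((3 * m - 2 * s)^2 * (3 * m + s))"
    using assms(1) by algebra
  also have "\<dots> = (3 * m - 2 * s)^2 * (3 * (k * (m - s)) + 4 * (s * k))"
    by algebra
  also have "\<dots> = 4 * ((3 * m - 2 * s)^2 * (a * 3 + c))"
    unfolding assms(2) assms(3)[symmetric] by algebra
  finally show ?thesis by simp
qed

lemma listed_imp_equation:
  assumes "listed_bt1 a x y n l c" and "a > 0" and "l > 0"
  shows "equation_holds a 1 x y n 1 l c"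
proof -
  define m :: int where "m = 3^(l - 1)"
  have l: "(3::int)^l = 3 * m" using \<open>l > 0\<close> by (simp add: m_def power_eq_if)
  have fam: ?thesis if "x = 3" "n = 1" "s = 1 \<or> s = -1" "c = s * k" "4 * a = k * (m - s)"
      "\<bar>y\<bar> = 3 * m - 2 * s" "3 * a + c \<noteq> 0" for s k
  proof -
    have "y^2 = (3 * m - 2 * s)^2" using that(6) by (metis power2_abs)
    moreover have "a * 3 * (3 * m)^2 + c = (3 * m - 2 * s)^2 * (a * 3 + c)"
      using that by (intro three_family_identity[of s c k]) auto
    ultimately show ?thesis using that(1,2,7) unfolding equation_holds_iff
      by (simp add: l mult.commute)
  qed
  from assms(1) show ?thesis unfolding listed_bt1_iff[OF \<open>l > 0\<close> m_def]
  proof (elim conjE disjE)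
    assume "x = 3" "n = 1" "c = -1" "4 * a = m + 1" "\<bar>y\<bar> = 3 * m + 2"
    then show ?thesis using \<open>a > 0\<close> by (intro fam[of "-1" 1]) auto
  next
    assume "x = 3" "n = 1" "c = 1" "4 * a = m - 1" "\<bar>y\<bar> = 3 * m - 2"
    then show ?thesis using \<open>a > 0\<close> by (intro fam[of 1 1]) auto
  next
    assume "x = 3" "n = 1" "c = -2" "2 * a = m + 1" "\<bar>y\<bar> = 3 * m + 2"
    then show ?thesis using \<open>a > 0\<close> by (intro fam[of "-1" 2]) auto
  next
    assume "x = 3" "n = 1" "c = 2" "2 * a = m - 1" "\<bar>y\<bar> = 3 * m - 2"
    then show ?thesis using \<open>a > 0\<close> by (intro fam[of 1 2]) auto
  next
    assume *: "c = -4" "l = 1" "n = 1" "a = 1" "x = 5" "\<bar>y\<bar> = 11"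
    then have "y^2 = 11^2" by (metis power2_abs)
    then show ?thesis using * by (simp add: equation_holds_iff)
  qed
qed

text \<open>The relation \<open>am\<close> is the case \<open>\<bar>S + 3\<bar> = 3^l\<close> of the
  classification. It determines \<open>a\<close>, and residues modulo 4 determine the parity of
  \<open>l\<close>. For \<open>c\<close> = 4 or -4 it would make \<open>a\<close> even, against the
  coprimality of \<open>a\<close> and \<open>c\<close>.\<close>

lemma three_family:
  fixes a c y m :: int
  assumes c: "c \<in> {1, -1, 2, -2, 4, -4}" and "a > 0" and "l > 0" and g: "gcd a c = 1"
    and m: "m = 3^(l - 1)" and am: "\<bar>4 * a + c\<bar> = \<bar>c\<bar> * m"
    and eq: "a * 3 * (3 * m)^2 + c = y^2 * (a * 3 + c)" and nz: "a * 3 + c \<noteq> 0"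
  shows "listed_bt1 a 3 y 1 l c"
proof -
  have m1: "m \<ge> 1" by (simp add: m)
  have y: "\<bar>y\<bar> = 3 * m - 2 * s" if "s = 1 \<or> s = -1" "c = s * k" "4 * a = k * (m - s)" for s k
  proof -
    have "(3 * m - 2 * s)^2 * (a * 3 + c) = y^2 * (a * 3 + c)"
      using that eq three_family_identity[of s c k a m] by auto
    then have "y^2 = (3 * m - 2 * s)^2" using nz by simp
    then have "\<bar>y\<bar> = \<bar>3 * m - 2 * s\<bar>" by (simp add: power2_eq_iff abs_eq_iff)
    then show ?thesis using m1 that(1) by auto
  qed
  have odd_a: "odd a" if "even c"
  proof
    assume "even a"
    with that have "2 dvd gcd a c" by simp
    with g show False by simp
  qed
  \<comment> \<open>The exponent in \<open>m\<close> is \<open>l - 1\<close>, so the parities are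
    swapped.\<close>
  have par: "m mod 4 = (if even l then 3 else 1)"
    using three_power_mod_4[of "l - 1"] \<open>l > 0\<close> m by auto
  show ?thesis
    unfolding listed_bt1_iff[OF \<open>l > 0\<close> m]
  proof -
    consider "c = 1" | "c = -1" | "c = 2" | "c = -2" | "c = 4" | "c = -4" using c by auto
    then show "3 = (3::int) \<and> 1 = (1::nat) \<and>
      (c = -1 \<and> even l \<and> 4 * a = m + 1 \<and> \<bar>y\<bar> = 3 * m + 2 \<or>
       c = 1 \<and> odd l \<and> 4 * a = m - 1 \<and> \<bar>y\<bar> = 3 * m - 2 \<or>
       c = -2 \<and> odd l \<and> 2 * a = m + 1 \<and> \<bar>y\<bar> = 3 * m + 2 \<or>
       c = 2 \<and> even l \<and> 2 * a = m - 1 \<and> \<bar>y\<bar> = 3 * m - 2) \<or>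
    c = -4 \<and> l = 1 \<and> 1 = (1::nat) \<and> a = 1 \<and> 3 = (5::int) \<and> \<bar>y\<bar> = 11"
    proof cases
      case 1
      then have a: "4 * a = m - 1" using am \<open>a > 0\<close> by simp
      then have "m mod 4 = 1" by presburger
      then show ?thesis using 1 a par y[of 1 1] by (auto split: if_splits)
    next
      case 2
      then have a: "4 * a = m + 1" using am \<open>a > 0\<close> by simp
      then have "m mod 4 = 3" by presburger
      then show ?thesis using 2 a par y[of "-1" 1] by (auto split: if_splits)
    next
      case 3
      then have a: "2 * a = m - 1" using am \<open>a > 0\<close> by simp
      moreover have "odd a" using odd_a 3 by simp
      ultimately have "m mod 4 = 3" by presburger
      then show ?thesis using 3 a par y[of 1 2] by (auto split: if_splits)
    next
      case 4
      then have a: "2 * a = m + 1" using am \<open>a > 0\<close> by simp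
      moreover have "odd a" using odd_a 4 by simp
      ultimately have "m mod 4 = 1" by presburger
      then show ?thesis using 4 a par y[of "-1" 2] by (auto split: if_splits)
    next
      case 5
      then have "a = m - 1" using am \<open>a > 0\<close> by simp
      moreover have "odd a" using odd_a 5 by simp
      moreover have "odd m" by (simp add: m)
      ultimately show ?thesis by simp
    next
      case 6
      then have "a = m + 1" using am \<open>a > 0\<close> m1 by simp
      moreover have "odd a" using odd_a 6 by simp
      moreover have "odd m" by (simp add: m)
      ultimately show ?thesis by simp
    qed
  qed
qed

lemma prime_3_int: "prime (3::int)" and prime_5_int: "prime (5::int)"
  by (simp_all only: prime_int_numeral_eq) simp_all

text \<open>If \<open>e = 1\<close>, the parameter is -6 and sizes suffice. If
  \<open>e \<ge> 2\<close>, 9 does not divide \<open>S\<close>, so 3 divides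
  \<open>a * x^n * t^2\<close> exactly once; this gives \<open>n = 1\<close>, and comparing powers
  of 3 and then sizes leaves \<open>x = 3\<close>.\<close>

lemma base_three:
  fixes a c x t S :: int
  assumes c: "c \<in> {1, -1, 2, -2, 4, -4}" and "x > 1" "n > 0" "t > 0" "a > 0" "l > 0"
    and S: "S * c = 4 * (a * x^n) * t^2" and S3: "3 dvd S"
    and e: "\<bar>S + 3\<bar> = 3^e" "e \<ge> 1" and xl: "x^l = t * 3^e"
  shows "x = 3 \<and> t = 1 \<and> n = 1"
proof -
  have "3 dvd (3::int)^e" using e(2) by simp
  then have "3 dvd x^l" unfolding xl by simp
  then have x3: "3 dvd x" using prime_3_int prime_dvd_power by blast
  then obtain r where r: "x = 3 * r" by auto
  have "r \<ge> 1" using r \<open>x > 1\<close> by simp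
  have "x \<ge> 3" using r \<open>r \<ge> 1\<close> by simp
  have t2: "t^2 \<ge> 1" using \<open>t > 0\<close> by (metis one_le_power int_one_le_iff_zero_less)
  have Xx: "x^n \<ge> x" using \<open>x > 1\<close> \<open>n > 0\<close> by (simp add: self_le_power)
  show ?thesis
  proof (cases "e = 1")
    case True
    have "S \<noteq> 0" using S assms by auto
    then have "S = - 6" using e(1) True by auto
    then have m: "4 * (a * x^n * t^2) = - 6 * c" using S by (simp add: mult.assoc)
    then have le: "a * x^n * t^2 \<le> 6" using c by auto
    have "1 * x^n * 1 \<le> a * x^n * t^2"
      using \<open>a > 0\<close> t2 \<open>x > 1\<close> by (intro mult_mono) auto
    then have "x^n \<le> 6" using le by simp
    have "n = 1"
    proof (rule ccontr)
      assume "n \<noteq> 1"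
      then have "n \<ge> 2" using \<open>n > 0\<close> by simp
      then have "x^2 \<le> x^n" using \<open>x > 1\<close> by (intro power_increasing) auto
      moreover have "3 * 3 \<le> x * x" using \<open>x \<ge> 3\<close> by (intro mult_mono) auto
      ultimately show False using \<open>x^n \<le> 6\<close> by (simp add: power2_eq_square)
    qed
    have "t = 1"
    proof (rule ccontr)
      assume "t \<noteq> 1"
      then have "t \<ge> 2" using \<open>t > 0\<close> by simp
      then have "t^2 \<ge> 2^2" by (intro power_mono) auto
      then have "1 * 3 * 4 \<le> a * x^n * t^2"
        using \<open>a > 0\<close> \<open>x \<ge> 3\<close> Xx by (intro mult_mono) auto
      then show False using le by simp
    qed
    have "x^l = 3" using xl True \<open>t = 1\<close> by simp
    moreover have "x^l \<ge> x" using \<open>x > 1\<close> \<open>l > 0\<close> by (simp add: self_le_power)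
    ultimately have "x = 3" using \<open>x \<ge> 3\<close> by simp
    then show ?thesis using \<open>n = 1\<close> \<open>t = 1\<close> by simp
  next
    case False
    then have "e \<ge> 2" using e(2) by simp
    then have "(3::int)^2 dvd 3^e" by (rule le_imp_power_dvd)
    then have "3^2 dvd S + 3" using e(1) by (metis dvd_abs_iff)
    then have "9 dvd S + 3" by simp
    then have S9: "\<not> 9 dvd S" by presburger
    have no9: "\<not> 9 dvd a * x^n * t^2"
    proof
      assume "9 dvd a * x^n * t^2"
      then have "9 dvd S * c" unfolding S by (simp add: mult.assoc)
      moreover have "coprime 3 c" using c prime_imp_coprime[OF prime_3_int, of c] by auto
      then have "coprime (3^2) c" by (simp only: coprime_power_left_iff simp_thms)
      then have "coprime 9 c" by simp
      ultimately show False using S9 coprime_dvd_mult_left_iff by blast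
    qed
    have nine: "(9::int) = 3 * 3" by simp
    have "n = 1"
    proof (rule ccontr)
      assume "n \<noteq> 1"
      then have "n \<ge> 2" using \<open>n > 0\<close> by simp
      then have "x^2 dvd x^n" by (rule le_imp_power_dvd)
      moreover have "9 dvd x^2" unfolding nine power2_eq_square using x3 by (intro mult_dvd_mono)
      ultimately have "9 dvd x^n" by (rule dvd_trans[rotated])
      with no9 show False by simp
    qed
    have r3: "\<not> 3 dvd r"
    proof
      assume "3 dvd r"
      then have "9 dvd x" unfolding nine r by (intro mult_dvd_mono) auto
      with no9 show False using \<open>n = 1\<close> by simp
    qed
    have t3: "\<not> 3 dvd t"
    proof
      assume "3 dvd t"
      then have "9 dvd t^2" unfolding nine power2_eq_square by (intro mult_dvd_mono)
      with no9 show False by simp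
    qed
    have xl': "3^l * r^l = t * 3^e" using xl unfolding r power_mult_distrib .
    \<comment> \<open>Since 3 divides neither \<open>r\<close> nor \<open>t\<close>, both sides of
      \<open>xl'\<close> have the same 3-part, so \<open>e = l\<close> and
      \<open>t = r^l\<close>.\<close>
    have "coprime (3^e) (r^l)" "coprime (3^l) t"
      using r3 t3 prime_imp_coprime[OF prime_3_int] by auto
    moreover have "3^e dvd 3^l * r^l" "3^l dvd t * 3^e"
      by (metis xl' dvd_triv_right, metis xl' dvd_triv_left)
    ultimately have "(3::int)^e dvd 3^l" "(3::int)^l dvd 3^e"
      using coprime_dvd_mult_left_iff coprime_dvd_mult_right_iff by blast+
    then have el: "(3::int)^e = 3^l" by (simp add: zdvd_antisym_nonneg)
    then have t: "t = r^l" using xl' by simp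
    \<comment> \<open>For \<open>r \<ge> 2\<close>, \<open>t^2 * x = 3 * r^(2*l+1)\<close> makes
      \<open>\<bar>S\<bar>\<close> at least \<open>6 * 4^l\<close>, against
      \<open>\<bar>S\<bar> \<le> 3^l + 3\<close>.\<close>
    have "r = 1"
    proof (rule ccontr)
      assume "r \<noteq> 1"
      then have "r \<ge> 2" using \<open>r \<ge> 1\<close> by simp
      then have "2^(2*l+1) \<le> r^(2*l+1)" by (intro power_mono) auto
      then have R: "r^(2*l+1) \<ge> 2 * 4^l" by (simp add: power_mult)
      have "S * c = 4 * (a * (3 * r^(2*l+1)))"
        unfolding S t r \<open>n = 1\<close> by (simp add: power_mult[symmetric] power_add mult_ac)
      then have "\<bar>S\<bar> * \<bar>c\<bar> = \<bar>4 * (a * (3 * r^(2*l+1)))\<bar>" by (metis abs_mult)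
      also have "\<dots> \<ge> 4 * (1 * (3 * r^(2*l+1)))"
        using \<open>a > 0\<close> \<open>r \<ge> 1\<close> by (simp add: abs_mult)
      finally have "\<bar>S\<bar> * \<bar>c\<bar> \<ge> 24 * 4^l" using R by simp
      moreover have "\<bar>S\<bar> * \<bar>c\<bar> \<le> \<bar>S\<bar> * 4" using c by (intro mult_left_mono) auto
      ultimately have "\<bar>S\<bar> \<ge> 6 * 4^l" by simp
      moreover have "\<bar>S\<bar> \<le> 3^l + 3" using e(1) el by linarith
      moreover have "(3::int)^l \<le> 4^l" by (intro power_mono) auto
      moreover have "(4::int)^l \<ge> 1" by simp
      ultimately show False by linarith
    qed
    then show ?thesis using r t \<open>n = 1\<close> by simp
  qed
qed

lemma dvd_prime_power_base:
  fixes a x p :: int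
  assumes "a * x^n = p" and "prime p" and "a > 0" and "x > 1" and "n > 0"
  shows "a = 1 \<and> x = p \<and> n = 1"
proof -
  have "x^1 dvd x^n" using \<open>n > 0\<close> by (intro le_imp_power_dvd) simp
  then have "x dvd p" using assms(1) by auto
  moreover have "x \<ge> 0" "x \<noteq> 1" using \<open>x > 1\<close> by auto
  ultimately have x: "x = p"
    using \<open>prime p\<close> unfolding prime_int_iff by blast
  have "n = 1"
  proof (rule ccontr)
    assume "n \<noteq> 1"
    then have "n \<ge> 2" using \<open>n > 0\<close> by simp
    then have "x^1 < x^n" using \<open>x > 1\<close> by (intro power_strict_increasing) auto
    moreover have "1 * x^n \<le> a * x^n" using \<open>a > 0\<close> \<open>x > 1\<close> by (intro mult_right_mono) auto
    ultimately show False using x assms(1) by simp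
  qed
  with x assms show ?thesis by simp
qed

section \<open>The two signs of b\<close>

text \<open>The descent applies with \<open>d = c\<close>, giving
  \<open>x^l = t * \<bar>lucasW S j\<bar>\<close>. A unit Lucas value gives
  \<open>\<bar>y\<bar> = 1\<close>; the other outcomes of the classification give the listed
  solutions.\<close>

lemma positive_case:
  fixes a b x y t c :: int
  assumes cs: "c \<in> {1, -1, 2, -2, 4, -4}" and x: "x > 1" and n: "n > 0" and t: "t > 0"
    and a: "a > 0" and l: "l > 0" and g: "gcd a c = 1"
    and b: "b > 0" and N: "a * b * t^2 * x^n + c > 0"
    and eq: "a * x^n * (x^l)^2 + c = b * y^2 * (a * b * t^2 * x^n + c)"
  shows "b = 1 \<and> (\<bar>y\<bar> = 1 \<and> x^l = t \<or> t = 1 \<and> listed_bt1 a x y n l c)"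
proof -
  define q where "q = a * x^n"
  define P where "P = a * b * t^2 * x^n + c"
  \<comment> \<open>The quotient is exact since \<open>c\<close> divides 4, so \<open>S\<close> = 4
    q t^2 / c is an integer.\<close>
  define k where "k = 4 div c"
  define S where "S = k * q * t^2"
  have kc: "k * c = 4" using cs by (auto simp: k_def)
  have S: "S * c = 4 * q * t^2" using kc by (simp add: S_def mult_ac)
  have q: "q > 0" using a x by (simp add: q_def)
  have P: "P = b * q * t^2 + c" by (simp add: P_def q_def mult_ac)
  interpret pell_descent b P q t c c
    by unfold_locales (use b N q t P cs P_def in auto)
  have "b * P * y^2 - q * (x^l)^2 = c" using eq by (simp add: P_def q_def algebra_simps)
  then have sol: "sol y (x^l)" by (simp add: sol_def)
  have "c dvd P \<and> odd (x^l - z0)" if "q * z0^2 = - c" for z0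
    using zero_solution[OF cs x n a g that[unfolded q_def]] l
    by (simp add: P q_def dvd_mult dvd_mult2)
  from solution_in_orbit[OF sol refl S this] obtain j
    where b1: "b = 1" and j: "\<bar>x^l\<bar> = t * \<bar>lucasW S j\<bar>" by blast
  have xl: "x^l = t * \<bar>lucasW S j\<bar>" using j x by simp
  have eq1: "q * (x^l)^2 + c = y^2 * P" using eq b1 by (simp add: q_def P_def)
  show ?thesis
  proof (cases "\<bar>lucasW S j\<bar> = 1")
    case True
    then have "x^l = t" using xl by simp
    then have "y^2 * P = 1 * P" using eq1 P b1 by simp
    then have "y^2 = 1" using pos(2) by simp
    then show ?thesis using b1 \<open>x^l = t\<close> by (simp add: abs_square_eq_1)
  next
    case False
    have S0: "S \<noteq> 0" using kc q t by (auto simp: S_def)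
    \<comment> \<open>Here the exponential shape enters: \<open>p\<close> divides
      \<open>x^l\<close>, hence \<open>x\<close>, hence the factor \<open>x^n\<close> of
      \<open>S\<close>.\<close>
    have primes: "p dvd S" if "prime p" "p dvd lucasW S j" for p
    proof -
      have "p dvd x^l" using that(2) xl by simp
      then have "p dvd x" using that(1) prime_dvd_power by blast
      then have "p dvd x^n" using n by (simp add: dvd_power_same dvd_trans dvd_power)
      then show ?thesis by (simp add: S_def q_def)
    qed
    have "S = - 5 \<and> \<bar>lucasW S j\<bar> = 5 \<or>
        3 dvd S \<and> \<bar>lucasW S j\<bar> = \<bar>S + 3\<bar> \<and> (\<exists>e\<ge>1. \<bar>S + 3\<bar> = 3^e)"
      using primes by (intro lucasW_classification[OF S0 False])
    then show ?thesis
    proof (elim disjE conjE exE)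
      assume S5: "S = - 5" and W: "\<bar>lucasW S j\<bar> = 5"
      \<comment> \<open>Divisibility by 4 and positivity leave \<open>c = - 4\<close> and
        \<open>q * t^2 = 5\<close>: the isolated solution with \<open>x = 5\<close>.\<close>
      have qt: "4 * (q * t^2) = - 5 * c" using S S5 by simp
      then have "4 dvd - 5 * c" by (metis dvd_triv_left)
      then have "4 dvd c" by presburger
      then have c4: "c = 4 \<or> c = - 4" using cs by auto
      have "q * t^2 > 0" using q t by simp
      then have c4: "c = - 4" using c4 qt by auto
      have "a * t^2 * x^n = 5" using qt c4 by (simp add: q_def mult_ac)
      then have a1: "a * t^2 = 1 \<and> x = 5 \<and> n = 1"
        using dvd_prime_power_base[OF _ prime_5_int _ x n] a t by simp
      then have "a = 1" "t^2 = 1" using a by (auto simp: zmult_eq_1_iff)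
      then have "t = 1" using t by (simp add: power2_eq_1_iff)
      have "5^l = (5::int)^1" using xl W a1 \<open>t = 1\<close> by simp
      then have "l = 1" by (rule power_inject_exp[THEN iffD1, rotated]) simp
      have "y^2 = 11^2"
        using eq1 P b1 a1 \<open>a = 1\<close> \<open>t = 1\<close> \<open>l = 1\<close> c4 by (simp add: q_def)
      then have "\<bar>y\<bar> = 11" unfolding power2_eq_iff by auto
      then show ?thesis
        using b1 c4 a1 \<open>a = 1\<close> \<open>t = 1\<close> \<open>l = 1\<close> listed_bt1_iff[OF l refl] by simp
    next
      fix e assume S3: "3 dvd S" and W: "\<bar>lucasW S j\<bar> = \<bar>S + 3\<bar>" and e: "e \<ge> 1" "\<bar>S + 3\<bar> = 3^e"
      have 1: "x = 3 \<and> t = 1 \<and> n = 1"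
        using S xl W e by (intro base_three[OF cs x n t a l _ S3 e(2,1)]) (simp_all add: q_def)
      then have "\<bar>S + 3\<bar> = 3^l" using xl W by simp
      define m :: int where "m = 3^(l - 1)"
      have l3: "(3::int)^l = 3 * m" using l by (simp add: m_def power_eq_if)
      have "3 * \<bar>4 * a + c\<bar> = \<bar>3 * (4 * a + c)\<bar>"
        by (simp only: abs_mult abs_numeral)
      also have "3 * (4 * a + c) = (S + 3) * c"
        using S 1 by (simp add: q_def algebra_simps)
      also have "\<bar>(S + 3) * c\<bar> = 3 * (\<bar>c\<bar> * m)"
        by (simp add: abs_mult \<open>\<bar>S + 3\<bar> = 3^l\<close> l3)
      finally have am: "\<bar>4 * a + c\<bar> = \<bar>c\<bar> * m" by simp
      have "listed_bt1 a 3 y 1 l c"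
        using eq1 pos(2) by (intro three_family[OF cs a l g m_def am]) (simp_all add: P q_def 1 b1 l3)
      then show ?thesis using 1 b1 by simp
    qed
  qed
qed

text \<open>The signs of \<open>b\<close> and of the denominator are absorbed in \<beta> and
  \<open>P\<close>, so the descent applies with \<open>d = - c\<close>. A reduced solution with
  nonzero \<open>y0\<close> forces \<open>P \<le> q * t^2\<close>, which bounds the
  parameters.\<close>

lemma negative_case:
  fixes a b x y t c :: int
  assumes cs: "c \<in> {1, -1, 2, -2, 4, -4}" and x: "x > 1" and n: "n > 0" and t: "t > 0"
    and a: "a > 0" and l: "l > 0" and g: "gcd a c = 1"
    and b: "b < 0" and N: "a * b * t^2 * x^n + c < 0"
    and eq: "a * x^n * (x^l)^2 + c = b * y^2 * (a * b * t^2 * x^n + c)"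
  shows "(a, b, x, y, n, t, l, c) \<in> exceptional_solutions"
proof -
  define q where "q = a * x^n"
  define P where "P = - (a * b * t^2 * x^n + c)"
  define \<beta> where "\<beta> = - b"
  define z where "z = x^l"
  have "x^1 \<le> x^n" using x n by (intro power_increasing) auto
  then have X2: "x^n \<ge> 2" using x by simp
  then have "1 * 2 \<le> a * x^n" using a by (intro mult_mono) auto
  then have q2: "q \<ge> 2" by (simp add: q_def)
  have z0: "z > 0" using x by (simp add: z_def)
  have P: "P = \<beta> * q * t^2 + - c" by (simp add: P_def \<beta>_def q_def mult_ac)
  interpret pell_descent \<beta> P q t c "- c"
    by unfold_locales (use b N q2 t P cs P_def \<beta>_def in auto)
  have eq1: "\<beta> * P * y^2 - q * z^2 = c"
    using eq by (simp add: P_def \<beta>_def q_def z_def algebra_simps)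
  then have sol: "sol y z" by (simp add: sol_def)
  obtain y0 w0 where s0: "sol y0 w0" "y0 \<ge> 0" "w0 \<ge> 0" "reduced y0"
    and par: "c dvd P \<Longrightarrow> even (z - w0)"
    using reduced_solution[OF sol] unfolding minus_dvd_iff by metis
  have s0': "\<beta> * P * y0^2 - q * w0^2 = c" using s0(1) by (simp add: sol_def)
  have le: "P * y0^2 \<le> q * t^2" using s0(4) cs by (auto simp: reduced_def)
  \<comment> \<open>With \<open>y0 = 0\<close>, \<open>w0\<close> would be odd while
    \<open>z = x^l\<close> is even, against the invariant parity.\<close>
  have y0: "y0 \<noteq> 0"
  proof
    assume "y0 = 0"
    then have "q * w0^2 = - c" using s0' by simp
    note zs = zero_solution[OF cs x n a g this[unfolded q_def]]
    have "c dvd P" using zs(2) by (simp add: P q_def dvd_mult dvd_mult2)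
    then show False using par zs(1,3) l by (simp add: z_def)
  qed
  define m where "m = q * t^2"
  have Pm: "P = \<beta> * m - c" by (simp add: P m_def mult_ac)
  have t2: "t^2 \<ge> 1" using t by (metis one_le_power int_one_le_iff_zero_less)
  have "2 * 1 \<le> m" unfolding m_def using q2 t2 by (intro mult_mono) auto
  then have m2: "m \<ge> 2" by simp
  have y02: "y0^2 \<ge> 1" using y0 s0(2) by (metis one_le_power int_one_le_iff_zero_less le_less)
  then have "P * 1 \<le> P * y0^2" using pos(2) by (intro mult_left_mono) auto
  then have Ple: "P \<le> m" using le by (simp add: m_def)
  \<comment> \<open>A negative \<open>c\<close> would give
    \<open>P = \<beta> * m - c > m\<close>.\<close>
  have c_pos: "c = 1 \<or> c = 2 \<or> c = 4"
  proof (rule ccontr)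
    assume "\<not> ?thesis"
    then have "c < 0" using cs by auto
    moreover have "1 * m \<le> \<beta> * m" using pos(1) m2 by (intro mult_right_mono) auto
    ultimately show False using Pm Ple by simp
  qed
  have even_c: "odd a" "even q \<Longrightarrow> even x" if "even c"
  proof -
    show "odd a"
    proof
      assume "even a"
      with that have "2 dvd gcd a c" by simp
      with g show False by simp
    qed
    then show "even q \<Longrightarrow> even x" by (auto simp: q_def)
  qed
  have even_z: "even z" if "even x" using that l by (simp add: z_def)
  have odd_z: "odd z" if "odd x" using that by (simp add: z_def)
  \<comment> \<open>For \<open>\<beta> \<ge> 2\<close> the bound gives
    \<open>m \<le> c \<le> 4\<close> and \<open>t = 1\<close>. Four triples remain, each
    contradictory modulo 2 or 4.\<close>
  have \<beta>1: "\<beta> = 1"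
  proof (rule ccontr)
    assume "\<beta> \<noteq> 1"
    then have "\<beta> \<ge> 2" using pos(1) by simp
    then have "2 * m \<le> \<beta> * m" using m2 by (intro mult_right_mono) auto
    then have "m \<le> c" using Pm Ple by simp
    have "t = 1"
    proof (rule ccontr)
      assume "t \<noteq> 1"
      then have "t \<ge> 2" using t by simp
      then have "t^2 \<ge> 2^2" by (intro power_mono) auto
      then have "2 * 4 \<le> m" unfolding m_def using q2 by (intro mult_mono) auto
      then show False using \<open>m \<le> c\<close> c_pos by auto
    qed
    then have qm: "q = m" by (simp add: m_def)
    have "\<beta> * 2 \<le> \<beta> * m" using m2 pos(1) by (intro mult_left_mono) auto
    then have \<beta>3: "\<beta> \<le> 4" using Pm Ple \<open>m \<le> c\<close> c_pos by auto
    have "c = 2 \<or> c = 4" using m2 \<open>m \<le> c\<close> c_pos by linarith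
    moreover have "m = 2 \<or> m = 3 \<or> m = 4" using m2 \<open>m \<le> c\<close> c_pos by linarith
    moreover have "\<beta> = 2 \<or> \<beta> = 3 \<or> \<beta> = 4" using \<beta>3 \<open>\<beta> \<ge> 2\<close> by linarith
    moreover have "\<beta> * m > c" "\<beta> * m \<le> m + c" using Pm Ple pos(2) by linarith+
    ultimately consider "m = 2" "\<beta> = 2" "c = 2" | "m = 2" "\<beta> = 3" "c = 4" |
      "m = 3" "\<beta> = 2" "c = 4" | "m = 4" "\<beta> = 2" "c = 4"
      by (elim disjE) simp_all
    then show False
    proof cases
      case 1
      then have "even z" using even_c(2) even_z qm by simp
      moreover have "z^2 = 2 * y^2 - 1" using eq1 Pm 1 qm by simp
      then have "odd (z^2)" by simp
      ultimately show False by simp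
    next
      case 2
      then have "even z" using even_c(2) even_z qm by simp
      then have "2^2 dvd z^2" by (intro dvd_power_same)
      then obtain u where u: "z^2 = 4 * u" by auto
      have y: "3 * y^2 - z^2 = 2" using eq1 Pm 2 qm by simp
      then have "3 * y^2 = 2 * (2 * u + 1)" by (simp add: u)
      then have "even (3 * y^2)" by simp
      then have "even y" by simp
      then have "2^2 dvd y^2" by (intro dvd_power_same)
      then obtain v where "y^2 = 4 * v" by auto
      with y u show False by presburger
    next
      case 3
      have "odd x"
      proof
        assume "even x"
        then have "even q" using n by (simp add: q_def)
        then show False using qm 3 by simp
      qed
      then have "odd (3 * z^2)" using odd_z by simp
      moreover have "3 * z^2 = 4 * (y^2 - 1)" using eq1 Pm 3 qm by simp
      ultimately show False by simp
    next
      case 4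
      then have "even z" using even_c(2) even_z qm by simp
      moreover have "z^2 = 2 * y^2 - 1" using eq1 Pm 4 qm by simp
      then have "odd (z^2)" by simp
      ultimately show False by simp
    qed
  qed
  then have b1: "b = - 1" and Pc: "P = m - c" using Pm by (simp_all add: \<beta>_def)
  have eq2: "(m - c) * y^2 - q * z^2 = c" using eq1 \<beta>1 Pc by simp
  \<comment> \<open>Otherwise \<open>4 * (m - c) \<le> m\<close>, so \<open>m = 5\<close> and
    \<open>c = 4\<close>. Then \<open>(\<bar>y\<bar> - 2) * (\<bar>y\<bar> + 2)\<close> is a power
    of 5 whose factors are not both divisible by 5, so \<open>\<bar>y\<bar> \<le> 3\<close>, too
    small for \<open>z \<ge> 5\<close>.\<close>
  have y01: "y0 = 1"
  proof (rule ccontr)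
    assume "y0 \<noteq> 1"
    then have "y0 \<ge> 2" using y0 s0(2) by simp
    then have "y0^2 \<ge> 2^2" by (intro power_mono) auto
    then have "P * 4 \<le> P * y0^2" using pos(2) by (intro mult_left_mono) auto
    then have "4 * (m - c) \<le> m" using le Pc by (simp add: m_def)
    then have m5: "m = 5" and c4: "c = 4" using c_pos pos(2) Pc by auto
    have "a * t^2 * x^n = 5" using m5 by (simp add: m_def q_def mult_ac)
    then have a1: "a * t^2 = 1 \<and> x = 5 \<and> n = 1"
      using dvd_prime_power_base[OF _ prime_5_int _ x n] a t by simp
    then have "a = 1" using a by (auto simp: zmult_eq_1_iff)
    then have "q = 5" using a1 by (simp add: q_def)
    have z5: "z = 5^l" using a1 by (simp add: z_def)
    have y2: "y^2 = 5 * z^2 + 4" using eq2 m5 c4 \<open>q = 5\<close> by simp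
    then have prod: "(\<bar>y\<bar> - 2) * (\<bar>y\<bar> + 2) = 5 * z^2"
      by (simp add: algebra_simps power2_eq_square)
    have "5 dvd z" using l by (simp add: z5)
    then have "z \<ge> 5" using z0 by (rule zdvd_imp_le)
    have no5: "\<not> 5 dvd \<bar>y\<bar> - 2"
    proof
      assume "5 dvd \<bar>y\<bar> - 2"
      then have "\<not> 5 dvd \<bar>y\<bar> + 2" by presburger
      then have "coprime (5^(2*l+1)) (\<bar>y\<bar> + 2)"
        using prime_imp_coprime[OF prime_5_int] by auto
      moreover have "\<bar>y\<bar> + 2 dvd 5^(2*l+1)"
        using prod by (simp add: z5 power_mult[symmetric] mult.commute) (metis dvd_triv_right)
      ultimately have "is_unit (\<bar>y\<bar> + 2)" by (meson coprime_common_divisor dvd_refl)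
      then show False by simp
    qed
    then have "coprime (5^(2*l+1)) (\<bar>y\<bar> - 2)"
      using prime_imp_coprime[OF prime_5_int] by auto
    moreover have "\<bar>y\<bar> - 2 dvd 5^(2*l+1)"
      using prod by (simp add: z5 power_mult[symmetric] mult.commute) (metis dvd_triv_left)
    ultimately have "is_unit (\<bar>y\<bar> - 2)" by (meson coprime_common_divisor dvd_refl)
    then have "\<bar>y\<bar> \<le> 3" by simp
    then have "\<bar>y\<bar>^2 \<le> 3^2" by (intro power_mono) auto
    then have "5 * z^2 \<le> 5" using y2 by simp
    moreover have "z^2 \<ge> 5^2" using \<open>z \<ge> 5\<close> by (intro power_mono) auto
    ultimately show False by simp
  qed
  \<comment> \<open>The reduced solution \<open>(1, w0)\<close> turns the equation into a
    factorisation of \<open>2 * c\<close>, which leaves four triples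
    \<open>(c, q, t)\<close>.\<close>
  have diff: "q * (t^2 - w0^2) = 2 * c"
    using s0' \<beta>1 Pc y01 by (simp add: m_def algebra_simps)
  define k where "k = t^2 - w0^2"
  have qk: "q * k = 2 * c" using diff by (simp add: k_def)
  then have "q dvd 2 * c" by (metis dvd_triv_left)
  then have "q \<le> 8" using c_pos by (auto dest: zdvd_imp_le)
  then have "q = 2 \<or> q = 3 \<or> q = 4 \<or> q = 5 \<or> q = 6 \<or> q = 7 \<or> q = 8"
    using q2 by presburger
  then have factor: "c = 1 \<and> q = 2 \<and> k = 1 \<or> c = 2 \<and> q = 2 \<and> k = 2 \<or> c = 2 \<and> q = 4 \<and> k = 1 \<or>
      c = 4 \<and> q = 2 \<and> k = 4 \<or> c = 4 \<and> q = 4 \<and> k = 2 \<or> c = 4 \<and> q = 8 \<and> k = 1"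
    using qk c_pos by (elim disjE) (simp; presburger)+
  then have "k \<in> {1, 2, 4}" by blast
  then have "k = 1 \<and> t = 1 \<or> k = 4 \<and> t = 2"
    by (rule small_square_difference[OF k_def[symmetric] t s0(3)])
  with factor have "c = 1 \<and> q = 2 \<and> t = 1 \<or> c = 2 \<and> q = 4 \<and> t = 1 \<or>
      c = 4 \<and> q = 2 \<and> t = 2 \<or> c = 4 \<and> q = 8 \<and> t = 1"
    by (elim disjE conjE) simp_all
  then consider "c = 1" "q = 2" "t = 1" | "c = 2" "q = 4" "t = 1" |
    "c = 4" "q = 2" "t = 2" | "c = 4" "q = 8" "t = 1"
    by blast
  note cases = this
  have a1: "a = 1"
  proof -
    have "a dvd q" by (simp add: q_def)
    from cases show ?thesis
    proof cases
      case 1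
      then show ?thesis
        using dvd_prime_power_base[OF q_def[symmetric, unfolded \<open>q = 2\<close>] two_is_prime_int a x n] by simp
    next
      case 2
      then show ?thesis using even_c(1) odd_dvd_power_two[of a 2] \<open>a dvd q\<close> a by simp
    next
      case 3
      then show ?thesis using even_c(1) odd_dvd_power_two[of a 1] \<open>a dvd q\<close> a by simp
    next
      case 4
      then show ?thesis using even_c(1) odd_dvd_power_two[of a 3] \<open>a dvd q\<close> a by simp
    qed
  qed
  then have xn: "x^n = q" by (simp add: q_def)
  have "x dvd q" unfolding xn[symmetric] using n by (simp add: dvd_power)
  also have "q dvd 2^3" using cases by cases simp_all
  finally have "x dvd 2^3" .
  then have "z dvd (2^3)^l" unfolding z_def by (rule dvd_power_same)
  then have z2: "z dvd 2^(3 * l)" by (simp only: power_mult)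
  have x_dvd_z: "x dvd z" using l by (simp add: z_def dvd_power)
  have fin: "x = 2 \<and> l = 1 \<and> \<bar>y\<bar> = 3" if "y^2 - 2 * z^2 = 1"
  proof -
    have "z = 2" "\<bar>y\<bar> = 3" using pell_two_power[OF that z0 z2] by auto
    then show ?thesis
      using dvd_prime_power_base[of 1 x l 2] two_is_prime_int x l by (simp add: z_def)
  qed
  have pow2: "n = i" if "(2::int)^n = 2^i" for n i :: nat using that by simp
  from cases show ?thesis
  proof cases
    case 1
    then have f: "x = 2 \<and> l = 1 \<and> \<bar>y\<bar> = 3" using eq2 by (intro fin) (simp add: m_def)
    then have "n = 1" using xn 1 by (intro pow2) simp
    moreover have "y = 3 \<or> y = - 3" using f by linarith
    ultimately show ?thesis using f 1 a1 b1 by (auto simp: exceptional_solutions_def)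
  next
    case 2
    then have f: "x = 2 \<and> l = 1 \<and> \<bar>y\<bar> = 3" using eq2 by (intro fin) (simp add: m_def)
    then have "n = 2" using xn 2 by (intro pow2) simp
    moreover have "y = 3 \<or> y = - 3" using f by linarith
    ultimately show ?thesis using f 2 a1 b1 by (auto simp: exceptional_solutions_def)
  next
    case 3
    have x2: "x = 2 \<and> n = 1"
      using dvd_prime_power_base[of 1 x n 2] two_is_prime_int x n xn 3 by simp
    then have "even z" using even_z by simp
    \<comment> \<open>In this case the Pell equation holds for half of \<open>z\<close>, so
      \<open>z = 4\<close> and \<open>l = 2\<close>: the exception with
      \<open>t = 2\<close>.\<close>
    then obtain w where w: "z = 2 * w" by auto
    have "w dvd 2^(3 * l)" using z2 unfolding w by (rule dvd_mult_right)
    moreover have "y^2 - 2 * w^2 = 1" using eq2 3 w by (simp add: m_def power_mult_distrib)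
    ultimately have "w = 2" "\<bar>y\<bar> = 3" using pell_two_power[of y w "3 * l"] z0 w by auto
    then have "l = 2" using w x2 by (intro pow2) (simp add: z_def)
    moreover have "y = 3 \<or> y = - 3" using \<open>\<bar>y\<bar> = 3\<close> by linarith
    ultimately show ?thesis using x2 3 a1 b1 by (auto simp: exceptional_solutions_def)
  next
    case 4
    then have f: "x = 2 \<and> l = 1 \<and> \<bar>y\<bar> = 3" using eq2 by (intro fin) (simp add: m_def)
    then have "n = 3" using xn 4 by (intro pow2) simp
    moreover have "y = 3 \<or> y = - 3" using f by linarith
    ultimately show ?thesis using f 4 a1 b1 by (auto simp: exceptional_solutions_def)
  qed
qed

section \<open>Solutions with b = |y| = 1 and assembly of the classification\<close>

lemma unit_solution_iff:
  fixes a x y t c :: int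
  assumes c: "c \<in> {1, -1, 2, -2, 4, -4}" and x: "x > 1" and n: "n > 0" and t: "t > 0"
    and a: "a > 0" and l: "l > 0" and y: "\<bar>y\<bar> = 1"
  shows "equation_holds a 1 x y n t l c \<longleftrightarrow> x^l = t"
proof
  have y2: "y^2 = 1" using y by (simp add: abs_square_eq_1)
  {
    assume "equation_holds a 1 x y n t l c"
    then have "(a * x^n) * (x^l)^2 = (a * x^n) * t^2"
      by (simp add: equation_holds_iff y2 mult_ac)
    then have "(x^l)^2 = t^2" using a x by simp
    then show "x^l = t" using t x by (simp add: power2_eq_iff_nonneg)
  next
    assume xl: "x^l = t"
    have "x^1 \<le> x^n" "x^1 \<le> x^l" using x n l by (intro power_increasing; simp)+
    then have 1: "x^n \<ge> 2" "t \<ge> 2" using x xl by simp_all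
    then have "t^2 \<ge> 2^2" by (intro power_mono) auto
    then have "1 * 4 * 2 \<le> a * t^2 * x^n" using a 1 by (intro mult_mono) auto
    then have "a * t^2 * x^n + c \<noteq> 0" using c by auto
    then show "equation_holds a 1 x y n t l c"
      by (simp add: equation_holds_iff y2 xl mult_ac)
  }
qed

lemma exceptional_imp_equation:
  "(a, b, x, y, n, t, l, c) \<in> exceptional_solutions \<Longrightarrow> equation_holds a b x y n t l c"
  by (auto simp: exceptional_solutions_def equation_holds_iff)

text \<open>As \<open>a * x^n * (x^l)^2 \<ge> 8\<close> exceeds \<open>\<bar>c\<bar>\<close>, the
  numerator is positive, so \<open>b\<close> and the denominator have the same sign; this separates
  the two cases.\<close>

lemma equation_imp_solution:
  fixes a b x y t c :: int
  assumes c: "c \<in> {1, -1, 2, -2, 4, -4}" and x: "x > 1" and n: "n > 0" and t: "t > 0"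
    and a: "a > 0" and l: "l > 0" and g: "gcd a c = 1"
    and holds: "equation_holds a b x y n t l c"
  shows "b = 1 \<and> (\<bar>y\<bar> = 1 \<and> x^l = t \<or> t = 1 \<and> listed_bt1 a x y n l c) \<or>
    (a, b, x, y, n, t, l, c) \<in> exceptional_solutions"
proof -
  define N where "N = a * b * t^2 * x^n + c"
  have eq: "a * x^n * (x^l)^2 + c = b * y^2 * (a * b * t^2 * x^n + c)"
    using holds by (simp add: equation_holds_iff)
  have "x^1 \<le> x^n" "x^1 \<le> x^l" using x n l by (intro power_increasing; simp)+
  then have 1: "x^n \<ge> 2" "x^l \<ge> 2" using x by simp_all
  then have "(x^l)^2 \<ge> 2^2" by (intro power_mono) auto
  then have "1 * 2 * 4 \<le> a * x^n * (x^l)^2" using a 1 by (intro mult_mono) auto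
  then have "a * x^n * (x^l)^2 + c > 0" using c by auto
  then have "y^2 * (b * N) > 0" unfolding eq N_def by (simp add: mult_ac)
  then have "b * N > 0" by (simp add: zero_less_mult_iff)
  then consider "b > 0" "N > 0" | "b < 0" "N < 0" by (auto simp: zero_less_mult_iff)
  then show ?thesis
  proof cases
    case 1
    then show ?thesis using positive_case[OF c x n t a l g _ _ eq] by (simp add: N_def)
  next
    case 2
    then show ?thesis using negative_case[OF c x n t a l g _ _ eq] by (simp add: N_def)
  qed
qed

theorem theorem4p25:
  fixes a b x y t c :: int and n l :: nat
  assumes "c \<in> {1, -1, 2, -2, 4, -4}"
    and "x > 1" and "n > 0" and "t > 0" and "a > 0" and "l > 0"
    and "gcd a c = 1"
  shows "(equation_holds a b x y n t l c \<longleftrightarrow>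
            (b = 1 \<and> t = 1 \<and> listed_bt1 a x y n l c) \<or>
            (b = 1 \<and> \<bar>y\<bar> = 1 \<and> x^l = t) \<or>
            (a, b, x, y, n, t, l, c) \<in> exceptional_solutions)
       \<and> (b = 1 \<and> \<bar>y\<bar> = 1 \<longrightarrow> (equation_holds a b x y n t l c \<longleftrightarrow> x^l = t))
       \<and> (b = 1 \<and> t = 1 \<longrightarrow> (equation_holds a b x y n t l c \<longleftrightarrow> listed_bt1 a x y n l c))"
proof -
  note sol = equation_imp_solution[OF assms, of b y]
  note unit = unit_solution_iff[OF assms(1-6), of y]
  note listed = listed_imp_equation[OF _ assms(5,6), of x y n c]
  \<comment> \<open>For \<open>b = t = 1\<close> this excludes \<open>x^l = t\<close>, and the
    exceptions have \<open>b = - 1\<close>, so only the list remains.\<close>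
  have "(1::int) < x^l" using assms by simp
  moreover have "b \<noteq> 1" if "(a, b, x, y, n, t, l, c) \<in> exceptional_solutions"
    using that by (auto simp: exceptional_solutions_def)
  ultimately have 1: "listed_bt1 a x y n l c"
    if "b = 1" "t = 1" "equation_holds a b x y n t l c"
    using sol that by auto
  have 2: "equation_holds a b x y n t l c"
    if "b = 1" "t = 1" "listed_bt1 a x y n l c"
    using listed that by simp
  have 3: "equation_holds a b x y n t l c \<longleftrightarrow> x^l = t" if "b = 1" "\<bar>y\<bar> = 1"
    using unit that by simp
  show ?thesis
    using sol 1 2 3 exceptional_imp_equation[of a b x y n t l c] by blast
qed

end
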